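(* Let $\alpha>0$ be irrational and let $\mathcal{P}$ be the $2$-square torus modified by the inclusion of a one-sided barrier on the common vertical edge of the two atomic squares, the barrier being a union of finitely many vertical intervals. Consider dissipative flow of slope $\alpha$ on $\mathcal{P}$, with recurrent set $\mathcal{R}(\mathcal{P};\alpha)$ and transient set $\mathcal{W}(\mathcal{P};\alpha)$. Then the following hold. (i) Each of the two sets $\mathcal{R}(\mathcal{P};\alpha)$ and $\mathcal{W}(\mathcal{P};\alpha)$ is a finite union of polygons with total area $1$ and with boundary edges that are vertical or of slope $\alpha$. (ii) The recurrent set $\mathcal{R}(\mathcal{P};\alpha)$ is invariant under dissipative flow of slope $\alpha$, and every half-infinite dissipative flow line of slope $\alpha$ in $\mathcal{R}(\mathcal{P};\alpha)$ is uniformly distributed in this set. (iii) Every half-infinite dissipative flow line of slope $\alpha$ that starts from a point in the transient set $\mathcal{W}(\mathcal{P};\alpha)$ eventually leaves this set, moves to the set $\mathcal{R}(\mathcal{P};\alpha)$ and is uniformly distributed there.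
   Context: The $2$-square torus is $[0,2)\times[0,1)$ with opposite edges identified by translation; its atomic squares are $[0,1)\times[0,1)$ and $[1,2)\times[0,1)$, with common vertical edge $\{1\}\times[0,1)$. The barrier is $B=\{1\}\times J$, where $J\subset[0,1)$ is a union of finitely many intervals of positive length (each of which may contain both, one or neither of its endpoints), and $A=\{0\}\times J$ is the corresponding subset of the left vertical edge. Dissipative flow of slope $\alpha$: a flow line moves from left to right at unit speed in the direction $(1,\alpha)$ as on the ordinary torus, except that whenever it hits a point $(1,y)\in B$ from the left it continues, in the same direction, from the corresponding point $(0,y)\in A$. (A flow line that starts on $B$ emanates from the right side of $B$.) For $t\ge0$, $\mathbf{T}_\alpha^{(t)}$ is the operator which advances a point along its dissipative flow line by time $t$. A point $P\in\mathcal{P}$ is wandering if there exist an open neighbourhood $D$ of $P$ and $t_0\ge0$ such that $D\cap\mathbf{T}_\alpha^{(t)}(D)=\emptyset$ for every $t>t_0$; otherwise it is non-wandering. The transient set $\mathcal{W}(\mathcal{P};\alpha)$ is the set of all wandering points, and the recurrent set $\mathcal{R}(\mathcal{P};\alpha)$ is the set of all non-wandering points. Uniformly distributed in a set $R$ of positive area: for a flow line $\mathcal{L}(t)$, $t\ge0$, and every polygon (or Jordan measurable set) $E\subset R$, $\frac1T\lambda_1(\{t\in[0,T]:\mathcal{L}(t)\in E\})\to\lambda_2(E)/\lambda_2(R)$ as $T\to\infty$, where $\lambda_d$ is $d$-dimensional Lebesgue measure. In the description of $\mathcal{R}(\mathcal{P};\alpha)$ and $\mathcal{W}(\mathcal{P};\alpha)$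 as finite unions of polygons, sets of $2$-dimensional Lebesgue measure $0$ are disregarded.
   Formalization: The recurrent set is shown invariant only up to one null set independent of time, since barrier points can be non-wandering yet flow into the transient set; the barrier has at least one interval, and uniform distribution is tested on Borel Jordan measurable sets. *)

theory Defs
  imports "HOL-Analysis.Analysis"
begin

text \<open>The 2-square torus is represented by its fundamental domain. Its topology is the quotient
  topology of the plane, so that a neighbourhood of a point on the boundary of the fundamental
  domain also contains points close to the opposite edge.\<close>

definition torus :: "(real \<times> real) set" where
  "torus = {0..<2} \<times> {0..<1}"

definition torus_proj :: "real \<times> real \<Rightarrow> real \<times> real" where
  "torus_proj p = (2 * frac (fst p / 2), frac (snd p))"

definition torus_open :: "(real \<times> real) set \<Rightarrow> bool" where
  "torus_open D \<longleftrightarrow> D \<subseteq> torus \<and> open (torus_proj -` D)"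

text \<open>The family of intervals is required to be non-empty: without a barrier the flow is the
  ordinary area-preserving one.\<close>

definition finite_interval_union :: "real set \<Rightarrow> bool" where
  "finite_interval_union J \<longleftrightarrow>
     (\<exists>\<I>. finite \<I> \<and> \<I> \<noteq> {} \<and> J = \<Union>\<I> \<and>
        (\<forall>I\<in>\<I>. is_interval I \<and> I \<subseteq> {0..<1} \<and> measure lborel I > 0))"

definition barrier :: "real set \<Rightarrow> (real \<times> real) set" where
  "barrier J = {1} \<times> J"

definition straight_flow :: "real \<Rightarrow> real \<Rightarrow> real \<times> real \<Rightarrow> real \<times> real" where
  "straight_flow \<alpha> t p = torus_proj (p + (t / sqrt (1 + \<alpha>\<^sup>2)) *\<^sub>R (1, \<alpha>))"

text \<open>The time needed to reach the next vertical edge. It is strictly positive, also for a point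
  that lies on a vertical edge, so that a point of the barrier starts on its right side.\<close>

definition edge_time :: "real \<Rightarrow> real \<times> real \<Rightarrow> real" where
  "edge_time \<alpha> p = (of_int (\<lfloor>fst p\<rfloor> + 1) - fst p) * sqrt (1 + \<alpha>\<^sup>2)"

definition jump :: "real set \<Rightarrow> real \<times> real \<Rightarrow> real \<times> real" where
  "jump J q = (if q \<in> barrier J then (0, snd q) else q)"

definition edge_hit :: "real \<Rightarrow> real set \<Rightarrow> real \<times> real \<Rightarrow> real \<times> real" where
  "edge_hit \<alpha> J p = jump J (straight_flow \<alpha> (edge_time \<alpha> p) p)"

lemma fst_edge_hit_Ints: "fst (edge_hit \<alpha> J p) \<in> \<int>"
proof -
  have pos: "sqrt (1 + \<alpha>\<^sup>2) > 0"
    by (simp add: add_pos_nonneg)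
  define k where "k = \<lfloor>fst p\<rfloor> + 1"
  have "fst (straight_flow \<alpha> (edge_time \<alpha> p) p) = 2 * frac (of_int k / 2)"
    using pos by (simp add: straight_flow_def torus_proj_def edge_time_def k_def)
  also have "\<dots> = of_int (k - 2 * \<lfloor>of_int k / 2 :: real\<rfloor>)"
    by (simp add: frac_def)
  finally have "fst (straight_flow \<alpha> (edge_time \<alpha> p) p) \<in> \<int>"
    by (metis Ints_of_int)
  then show ?thesis
    by (simp add: edge_hit_def jump_def)
qed

function dissipative_flow :: "real \<Rightarrow> real set \<Rightarrow> real \<Rightarrow> real \<times> real \<Rightarrow> real \<times> real" where
  "dissipative_flow \<alpha> J t p =
     (if t < edge_time \<alpha> p then straight_flow \<alpha> t p
      else dissipative_flow \<alpha> J (t - edge_time \<alpha> p) (edge_hit \<alpha> J p))"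
  by pat_completeness auto
termination
proof (relation "Wellfounded.measure (\<lambda>(\<alpha>, J, t, p). nat (\<lfloor>fst p + t / sqrt (1 + \<alpha>\<^sup>2)\<rfloor> - \<lfloor>fst p\<rfloor>))")
  fix \<alpha> t :: real and J :: "real set" and p :: "real \<times> real"
  assume late: "\<not> t < edge_time \<alpha> p"
  define s where "s = sqrt (1 + \<alpha>\<^sup>2)"
  have pos: "s > 0"
    by (simp add: s_def add_pos_nonneg)
  define k where "k = \<lfloor>fst p\<rfloor> + 1"
  obtain m where m: "fst (edge_hit \<alpha> J p) = of_int m"
    using fst_edge_hit_Ints by (metis Ints_cases)
  have e: "edge_time \<alpha> p / s = of_int k - fst p"
    using pos by (simp add: edge_time_def s_def k_def)
  have "edge_time \<alpha> p / s \<le> t / s"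
    using late pos by (simp add: divide_right_mono)
  then have "of_int k \<le> fst p + t / s"
    using e by linarith
  then have k: "k \<le> \<lfloor>fst p + t / s\<rfloor>"
    by (simp add: le_floor_iff)
  have "of_int m + (t - edge_time \<alpha> p) / s = fst p + t / s + of_int (m - k)"
    using e by (simp add: diff_divide_distrib)
  then have "\<lfloor>of_int m + (t - edge_time \<alpha> p) / s\<rfloor> = \<lfloor>fst p + t / s\<rfloor> + (m - k)"
    by (metis floor_add_int)
  then show "((\<alpha>, J, t - edge_time \<alpha> p, edge_hit \<alpha> J p), \<alpha>, J, t, p)
      \<in> Wellfounded.measure (\<lambda>(\<alpha>, J, t, p). nat (\<lfloor>fst p + t / sqrt (1 + \<alpha>\<^sup>2)\<rfloor> - \<lfloor>fst p\<rfloor>))"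
    using k m by (simp add: s_def k_def)
qed auto

declare dissipative_flow.simps [simp del]

definition wandering :: "real \<Rightarrow> real set \<Rightarrow> real \<times> real \<Rightarrow> bool" where
  "wandering \<alpha> J p \<longleftrightarrow>
     (\<exists>D t\<^sub>0. torus_open D \<and> p \<in> D \<and> t\<^sub>0 \<ge> 0 \<and> (\<forall>t>t\<^sub>0. D \<inter> dissipative_flow \<alpha> J t ` D = {}))"

definition transient_set :: "real \<Rightarrow> real set \<Rightarrow> (real \<times> real) set" where
  "transient_set \<alpha> J = {p \<in> torus. wandering \<alpha> J p}"

definition recurrent_set :: "real \<Rightarrow> real set \<Rightarrow> (real \<times> real) set" where
  "recurrent_set \<alpha> J = {p \<in> torus. \<not> wandering \<alpha> J p}"

text \<open>Polygons live in the plane and are projected to the torus: cutting them along the boundary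
  of the fundamental domain would introduce horizontal edges. Since every polygon is a finite
  union of convex ones, and here even of ones with edges in the same two directions, finite unions
  of convex polygons suffice.\<close>

definition slanted_polygon :: "real \<Rightarrow> (real \<times> real) set \<Rightarrow> bool" where
  "slanted_polygon \<alpha> Q \<longleftrightarrow>
     polytope Q \<and> aff_dim Q = 2 \<and>
     (\<forall>E. E edge_of Q \<longrightarrow>
        (\<forall>p\<in>E. \<forall>q\<in>E. fst p = fst q) \<or>
        (\<forall>p\<in>E. \<forall>q\<in>E. snd q - snd p = \<alpha> * (fst q - fst p)))"

text \<open>Equality with the union of the polygons is up to a set of measure zero.\<close>

definition finite_slanted_polygon_union :: "real \<Rightarrow> (real \<times> real) set \<Rightarrow> bool" where
  "finite_slanted_polygon_union \<alpha> S \<longleftrightarrow>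
     (\<exists>\<Q>. finite \<Q> \<and> (\<forall>Q\<in>\<Q>. slanted_polygon \<alpha> Q) \<and>
        negligible (sym_diff S (torus_proj ` \<Union>\<Q>)))"

text \<open>Exact invariance fails on null sets. If, for example, the barrier is the whole edge, then
  the points of the barrier are non-wandering, being limits of recurrent points on their left, but
  the flow takes them into the interior of the right square, which is wandering. The exceptional
  null set does not depend on the time.\<close>

definition flow_invariant :: "real \<Rightarrow> real set \<Rightarrow> (real \<times> real) set \<Rightarrow> bool" where
  "flow_invariant \<alpha> J S \<longleftrightarrow>
     (\<exists>N. negligible N \<and> (\<forall>t\<ge>0. dissipative_flow \<alpha> J t ` (S - N) = S - N))"

definition jordan_measurable :: "(real \<times> real) set \<Rightarrow> bool" where
  "jordan_measurable E \<longleftrightarrow> bounded E \<and> negligible (frontier E)"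

text \<open>Test sets are Borel, as all polygons are, because the time spent in a Jordan measurable set
  need not be measurable: the set may contain an arbitrary subset of a segment of the flow line.\<close>

definition uniformly_distributed :: "(real \<Rightarrow> real \<times> real) \<Rightarrow> (real \<times> real) set \<Rightarrow> bool" where
  "uniformly_distributed L R \<longleftrightarrow>
     measure lebesgue R > 0 \<and>
     (\<forall>E. E \<subseteq> R \<and> E \<in> sets borel \<and> jordan_measurable E \<longrightarrow>
        ((\<lambda>T. measure lebesgue {t \<in> {0..T}. L t \<in> E} / T) \<longlongrightarrow>
           measure lebesgue E / measure lebesgue R) at_top)"

end

theory Submission
  imports Defs "HOL-Analysis.Kronecker_Approximation_Theorem"
begin

text \<open>Modulo 1 the height of a flow line on the vertical edges moves by the rotation by \<open>\<alpha>\<close>, whether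
  or not it is sent back by the barrier. At a height in \<open>J\<close> every flow line continues in square 0,
  whatever square it came from, and at any other height it changes the square. As every orbit of the
  rotation visits \<open>J\<close> within bounded time, all flow lines enter within bounded time the set
  of points whose square is the parity of the time since the last visit of the height to
  \<open>J\<close>. This set contains exactly one of the two points of the torus above each point of the unit
  torus; so it has area 1, the flow on it is the linear flow on the unit torus, and
  equidistribution is that of the linear flow. It consists of non-wandering points, since
  the backward orbit of such a point in the unit torus, lifted to the right square, comes back
  close to it, and up to a null set there are no other ones.\<close>

subsection \<open>Equidistribution of linear flow on the unit torus\<close>

text \<open>The flow is not injective and does not preserve area on the 2-square torus, so
  equidistribution cannot be argued there directly. All exact statements are therefore proved for
  \<open>attractor\<close>, which is defined by the arithmetic of heights: the flow maps it onto
  itself, and its projection to the unit torus is bijective, also at the endpoints of the intervals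
  and on the vertical edges. Wandering, a topological notion, is compared with it only by two
  inclusions; on the null set \<open>grid\<close>, where the square prescribed by
  \<open>sync\<close> may change, a non-wandering point can lie outside \<open>attractor\<close>.

  That the visits to \<open>J\<close> have bounded gaps, and do not merely exist, is used twice: it
  gives one time after which every flow line is synchronised, as the neighbourhood of a wandering
  point requires, and it makes \<open>sync\<close> depend on finitely many rotated copies of
  \<open>J\<close>, whence finitely many polygons.\<close>

text \<open>Kronecker's theorem gives a hitting time for each target; uniformity in \<open>y\<close>
  comes from discretisation. The finitely many targets \<open>j / M\<close> are hit within
  \<open>\<epsilon> / 2\<close>, every residue of \<open>- y\<close> is that close to one of them,
  and the sum of the hitting times bounds them all.\<close>

lemma rotation_bounded_dense:
  fixes \<alpha> \<epsilon> :: real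
  assumes "\<alpha> \<notin> \<rat>" and "\<epsilon> > 0"
  obtains N :: nat where "\<And>y. \<exists>n\<le>N. \<exists>k::int. \<bar>y + real n * \<alpha> - of_int k\<bar> < \<epsilon>"
proof -
  obtain M :: nat where M: "M > 0" "1 / M < \<epsilon> / 2"
    using assms(2) by (metis gr_zeroI half_gt_zero inverse_eq_divide real_arch_inverse)
  have "\<exists>n::nat. \<bar>frac (real n * \<alpha>) - real j / M\<bar> < \<epsilon> / 2" if "j < M" for j
    using Kronecker_approx_1_explicit[of \<alpha> "real j / M" "\<epsilon> / 2"] assms that by fastforce
  then obtain n :: "nat \<Rightarrow> nat" where n: "\<And>j. j < M \<Longrightarrow> \<bar>frac (real (n j) * \<alpha>) - real j / M\<bar> < \<epsilon> / 2"
    by metis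
  have "\<exists>m\<le>\<Sum>j<M. n j. \<exists>k::int. \<bar>y + real m * \<alpha> - of_int k\<bar> < \<epsilon>" for y
  proof -
    define t where "t = frac (- y)"
    define j where "j = nat \<lfloor>t * M\<rfloor>"
    have t: "0 \<le> t" "t < 1"
      by (auto simp: t_def frac_lt_1)
    have j: "real j \<le> t * M" "t * M < real j + 1"
      using t M by (auto simp: j_def)
    have "real j < M"
      using j(1) mult_strict_right_mono[of t 1 "real M"] t(2) M(1) by linarith
    then have jM: "j < M"
      by simp
    have "real j / M \<le> t" "t < real j / M + 1 / M"
      using j M(1) by (simp_all add: field_simps)
    with M n[OF jM] have "\<bar>frac (real (n j) * \<alpha>) - t\<bar> < \<epsilon>"
      by linarith
    then have "\<bar>y + real (n j) * \<alpha> - of_int (\<lfloor>real (n j) * \<alpha>\<rfloor> - \<lfloor>- y\<rfloor>)\<bar> < \<epsilon>"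
      by (simp add: t_def frac_def algebra_simps)
    moreover have "n j \<le> (\<Sum>j<M. n j)"
      using jM by (intro member_le_sum) auto
    ultimately show ?thesis
      by blast
  qed
  then show ?thesis
    using that by blast
qed

lemma periodic_add_int:
  fixes g :: "'a::real_vector \<Rightarrow> 'b"
  assumes "\<And>x. g (x + e) = g x"
  shows "g (x + of_int k *\<^sub>R e) = g x"
proof -
  have n: "g (x + real n *\<^sub>R e) = g x" for x and n :: nat
  proof (induction n)
    case (Suc n)
    have "x + real (Suc n) *\<^sub>R e = x + real n *\<^sub>R e + e"
      by (simp add: scaleR_add_left)
    then show ?case
      using Suc assms by metis
  qed simp
  show ?thesis
  proof (cases "k \<ge> 0")
    case True
    then show ?thesis
      using n[of x "nat k"] by simp
  next
    case False
    then show ?thesis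
      using n[of "x + of_int k *\<^sub>R e" "nat (-k)"] by simp
  qed
qed

lemma integral_unit_interval_periodic:
  fixes g :: "real \<Rightarrow> real"
  assumes cont: "continuous_on UNIV g" and per: "\<And>x. g (x + 1) = g x"
  shows "integral {0..1} (\<lambda>x. g (x + c)) = integral {0..1} g"
proof -
  define r where "r = frac c"
  have r: "0 \<le> r" "r < 1"
    by (auto simp: r_def frac_lt_1)
  have int: "g integrable_on {a..b}" for a b
    using cont by (intro integrable_continuous_interval continuous_on_subset[OF cont]) auto
  have shift: "g (x + c) = g (x + r)" for x
    using periodic_add_int[of g 1 "x + r" "\<lfloor>c\<rfloor>"] per by (simp add: r_def frac_def)
  have "integral {0..1} (\<lambda>x. g (x + c)) = integral {0..1} (\<lambda>x. g (x + r))"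
    by (simp add: shift)
  also have "\<dots> = integral {r..1 + r} g"
    using integral_shift_real_ivl[of r r "1 + r" g] by simp
  also have "\<dots> = integral {r..1} g + integral {1..1 + r} g"
    using r by (intro Henstock_Kurzweil_Integration.integral_combine[symmetric] int) auto
  also have "integral {1..1 + r} g = integral {0..r} g"
    using integral_shift_real_ivl[of 1 1 "1 + r" g] per by simp
  also have "integral {r..1} g + integral {0..r} g = integral {0..1} g"
    using r by (subst add.commute, intro Henstock_Kurzweil_Integration.integral_combine int) auto
  finally show ?thesis .
qed

text \<open>One coordinate is treated at a time, with Fubini exchanging the order so that the
  shifted variable is the inner one.\<close>

lemma integral_unit_square_periodic:
  fixes f :: "real \<times> real \<Rightarrow> real"
  assumes cont: "continuous_on UNIV f"
    and per: "\<And>p. f (p + (1, 0)) = f p" "\<And>p. f (p + (0, 1)) = f p"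
  shows "integral (cbox (0, 0) (1, 1)) (\<lambda>q. f (q + w)) = integral (cbox (0, 0) (1, 1)) f"
proof -
  obtain a b where w: "w = (a, b)"
    by fastforce
  have perx: "f (x + 1, y) = f (x, y)" and pery: "f (x, y + 1) = f (x, y)" for x y
    using per[of "(x, y)"] by auto
  have contc: "continuous_on S (\<lambda>z. f (g z))" if "continuous_on S g" for g and S :: "'a::topological_space set"
    by (rule continuous_on_compose2[OF cont that]) auto
  have "integral (cbox (0, 0) (1, 1)) (\<lambda>q. f (q + w))
      = integral (cbox 0 1) (\<lambda>x. integral (cbox 0 1) (\<lambda>y. f (x + a, y + b)))"
    by (subst integral_prod_continuous) (auto simp: w intro!: contc continuous_intros)
  also have "\<dots> = integral (cbox 0 1) (\<lambda>x. integral (cbox 0 1) (\<lambda>y. f (x + a, y)))"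
    using integral_unit_interval_periodic[of "\<lambda>y. f (_, y)", OF contc pery] 
    by (simp add: continuous_intros)
  also have "\<dots> = integral (cbox 0 1) (\<lambda>y. integral (cbox 0 1) (\<lambda>x. f (x + a, y)))"
    by (rule integral_swap_continuous)
       (auto simp: case_prod_unfold intro!: contc continuous_intros)
  also have "\<dots> = integral (cbox 0 1) (\<lambda>y. integral (cbox 0 1) (\<lambda>x. f (x, y)))"
    using integral_unit_interval_periodic[of "\<lambda>x. f (x, _)", OF contc perx] 
    by (simp add: continuous_intros)
  also have "\<dots> = integral (cbox 0 1) (\<lambda>x. integral (cbox 0 1) (\<lambda>y. f (x, y)))"
    by (rule integral_swap_continuous)
       (auto simp: case_prod_unfold intro!: contc continuous_intros)
  also have "\<dots> = integral (cbox (0, 0) (1, 1)) f"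
    by (subst integral_prod_continuous) (auto intro!: contc continuous_intros)
  finally show ?thesis .
qed

text \<open>The difference is the integral over \<open>{0..s}\<close> minus that over
  \<open>{T..T + s}\<close>, both between 0 and \<open>s\<close>. So a delay of the start becomes
  negligible after division by \<open>T\<close>.\<close>

lemma orbit_integral_shift:
  fixes f :: "real \<Rightarrow> real"
  assumes cont: "continuous_on UNIV f" and bnd: "\<And>x. 0 \<le> f x \<and> f x \<le> 1" and "0 \<le> s" "0 \<le> T"
  shows "\<bar>integral {0..T} f - integral {0..T} (\<lambda>t. f (t + s))\<bar> \<le> s"
proof -
  have int: "f integrable_on {a..b}" for a b
    by (intro integrable_continuous_interval continuous_on_subset[OF cont]) auto
  have b: "0 \<le> integral {a..b} f \<and> integral {a..b} f \<le> b - a" if "a \<le> b" for a b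
    using integral_le[OF int[of a b], of "\<lambda>_. 1"] integral_nonneg[OF int[of a b]] bnd that by auto
  have "integral {0..T} (\<lambda>t. f (t + s)) = integral {s..T + s} f"
    using integral_shift_real_ivl[of s s "T + s" f] by simp
  moreover have "integral {0..s} f + integral {s..T + s} f = integral {0..T + s} f"
    using assms by (intro Henstock_Kurzweil_Integration.integral_combine int) auto
  moreover have "integral {0..T} f + integral {T..T + s} f = integral {0..T + s} f"
    using assms by (intro Henstock_Kurzweil_Integration.integral_combine int) auto
  ultimately show ?thesis
    using b[of 0 s] b[of T "T + s"] assms(3) by auto
qed

text \<open>Orbit averages from any two base points almost agree, because an orbit enters every small
  disc within bounded time; averaging over the base point then yields the space average.\<close>

lemma linear_flow_average:
  fixes f :: "real \<times> real \<Rightarrow> real" and \<alpha> a L :: real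
  assumes irr: "\<alpha> \<notin> \<rat>" and a: "a > 0"
    and lip: "\<And>p q. \<bar>f p - f q\<bar> \<le> L * dist p q"
    and bnd: "\<And>p. 0 \<le> f p \<and> f p \<le> 1"
    and per: "\<And>p. f (p + (1, 0)) = f p" "\<And>p. f (p + (0, 1)) = f p"
  shows "((\<lambda>T. integral {0..T} (\<lambda>t. f (p + t *\<^sub>R (a, \<alpha> * a))) / T)
           \<longlongrightarrow> integral (cbox (0, 0) (1, 1)) f) at_top"
proof -
  define w where "w = (a, \<alpha> * a)"
  define I where "I = (\<lambda>p T. integral {0..T} (\<lambda>t. f (p + t *\<^sub>R w)))"
  define M where "M = integral (cbox (0, 0) (1, 1)) f"
  have L0: "L \<ge> 0"
    using lip[of "(0,0)" "(1,0)"] by (simp add: dist_Pair_Pair)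
  have cont: "continuous_on UNIV f"
  proof (rule lipschitz_on_continuous_on)
    show "L-lipschitz_on UNIV f"
      using lip L0 by (intro lipschitz_onI) (auto simp: dist_real_def)
  qed
  have contc: "continuous_on S (\<lambda>z. f (g z))" if "continuous_on S g" for g and S :: "'a::topological_space set"
    by (rule continuous_on_compose2[OF cont that]) auto
  have pers: "f (q + (of_int m, of_int k)) = f q" for q and m k :: int
  proof -
    have "f (q + (of_int m, of_int k)) = f ((q + of_int m *\<^sub>R (1, 0)) + of_int k *\<^sub>R (0, 1))"
      by (simp add: plus_prod_def)
    then show ?thesis
      by (simp only: periodic_add_int[of f, OF per(1)] periodic_add_int[of f, OF per(2)])
  qed
  \<comment> \<open>Two errors occur: delaying an orbit until it is close to another costs at most
    \<open>S\<close>, independent of \<open>T\<close>, and the remaining distance, less than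
    \<delta>, costs at most \<open>L * \<delta>\<close> per unit of time.\<close>
  have key: "\<exists>S\<ge>0. \<forall>T>0. \<bar>I p T / T - M\<bar> \<le> S / T + L * \<delta>" if "\<delta> > 0" for \<delta>
  proof -
    obtain N :: nat where N: "\<And>y. \<exists>n\<le>N. \<exists>k::int. \<bar>y + real n * \<alpha> - of_int k\<bar> < \<delta>"
      using rotation_bounded_dense[OF irr \<open>\<delta> > 0\<close>] by blast
    define S where "S = (real N + 1) / a"
    have close: "\<bar>I p T - I q T\<bar> \<le> S + T * (L * \<delta>)" if "T > 0" for q T
    proof -
      \<comment> \<open>The orbit of \<open>p\<close> reaches an abscissa congruent to that of
        \<open>q\<close> after \<open>x + of_int \<lceil>- x\<rceil>\<close> horizontal units, a
        number in [0, 1); \<open>y\<close> is its height relative to \<open>q\<close> there. Each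
        further unit adds \<alpha> to this offset, until after \<open>n\<close> of them it is \<eta>
        modulo 1.\<close>
      define x where "x = fst q - fst p"
      define y where "y = snd p - snd q + \<alpha> * (x + of_int \<lceil>- x\<rceil>)"
      obtain n k where n: "n \<le> N" and k: "\<bar>y + real n * \<alpha> - of_int k\<bar> < \<delta>"
        using N[of y] by blast
      define \<eta> where "\<eta> = y + real n * \<alpha> - of_int k"
      define s where "s = (x + of_int \<lceil>- x\<rceil> + real n) / a"
      have "0 \<le> x + of_int \<lceil>- x\<rceil>" "x + of_int \<lceil>- x\<rceil> < 1"
        by linarith+
      then have s: "0 \<le> s" "s \<le> S"
        using a n by (auto simp: s_def S_def intro!: divide_right_mono)
      have sa: "s * a = x + of_int \<lceil>- x\<rceil> + real n"
        using a by (simp add: s_def)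
      have shifted: "p + s *\<^sub>R w = (q + (0, \<eta>)) + (of_int (\<lceil>- x\<rceil> + int n), of_int k)"
      proof (rule prod_eqI)
        show "fst (p + s *\<^sub>R w) = fst ((q + (0, \<eta>)) + (of_int (\<lceil>- x\<rceil> + int n), of_int k))"
          using sa by (simp add: w_def x_def)
        have "s * (\<alpha> * a) = \<alpha> * (x + of_int \<lceil>- x\<rceil> + real n)"
          using sa by (metis mult.assoc mult.commute)
        then show "snd (p + s *\<^sub>R w) = snd ((q + (0, \<eta>)) + (of_int (\<lceil>- x\<rceil> + int n), of_int k))"
          by (simp add: w_def y_def \<eta>_def algebra_simps)
      qed
      have eq: "f (p + (t + s) *\<^sub>R w) = f (q + t *\<^sub>R w + (0, \<eta>))" for t
      proof -
        have "p + (t + s) *\<^sub>R w = (p + s *\<^sub>R w) + t *\<^sub>R w"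
          by (simp add: scaleR_add_left add_ac)
        also have "\<dots> = q + t *\<^sub>R w + (0, \<eta>) + (of_int (\<lceil>- x\<rceil> + int n), of_int k)"
          unfolding shifted by (simp only: add_ac)
        finally show ?thesis
          by (simp only: pers)
      qed
      have "\<bar>I p T - integral {0..T} (\<lambda>t. f (p + (t + s) *\<^sub>R w))\<bar> \<le> s"
        unfolding I_def using bnd s that
        by (intro orbit_integral_shift) (auto intro!: contc continuous_intros)
      moreover have "\<bar>integral {0..T} (\<lambda>t. f (p + (t + s) *\<^sub>R w)) - I q T\<bar> \<le> T * (L * \<delta>)"
      proof -
        have "norm (integral {0..T} (\<lambda>t. f (p + (t + s) *\<^sub>R w) - f (q + t *\<^sub>R w)))
            \<le> integral {0..T} (\<lambda>t. L * \<delta>)"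
        proof (rule integral_norm_bound_integral)
          fix t assume "t \<in> {0..T}"
          have "\<bar>f (q + t *\<^sub>R w + (0, \<eta>)) - f (q + t *\<^sub>R w)\<bar> \<le> L * \<bar>\<eta>\<bar>"
            using lip[of "q + t *\<^sub>R w + (0, \<eta>)" "q + t *\<^sub>R w"] by (simp add: dist_norm)
          also have "\<dots> \<le> L * \<delta>"
            using k L0 by (intro mult_left_mono) (auto simp: \<eta>_def)
          finally show "norm (f (p + (t + s) *\<^sub>R w) - f (q + t *\<^sub>R w)) \<le> L * \<delta>"
            using eq by simp
        qed (auto intro!: integrable_continuous_interval contc continuous_intros)
        also have "integral {0..T} (\<lambda>t. f (p + (t + s) *\<^sub>R w) - f (q + t *\<^sub>R w))
            = integral {0..T} (\<lambda>t. f (p + (t + s) *\<^sub>R w)) - I q T"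
          unfolding I_def
          by (intro integral_diff integrable_continuous_interval contc continuous_intros)
        finally show ?thesis
          using that by (simp add: mult.left_commute)
      qed
      ultimately show ?thesis
        using s by linarith
    qed
    \<comment> \<open>Every translate of \<open>f\<close> has the same integral, so the mean of
      \<open>I q T\<close> over all base points is exactly \<open>T * M\<close>; being close to
      every \<open>I q T\<close> thus means being close to the space average.\<close>
    have mean: "integral (cbox (0, 0) (1, 1)) (\<lambda>q. I q T) = T * M" if "T > 0" for T
    proof -
      have "integral (cbox (0, 0) (1, 1)) (\<lambda>q. I q T)
          = integral (cbox 0 T) (\<lambda>t. integral (cbox (0, 0) (1, 1)) (\<lambda>q. f (q + t *\<^sub>R w)))"
        unfolding I_def box_real[symmetric]
        by (rule integral_swap_continuous)
           (auto simp: case_prod_unfold intro!: contc continuous_intros)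
      also have "\<dots> = T * M"
        using that by (simp add: integral_unit_square_periodic[OF cont per] M_def)
      finally show ?thesis .
    qed
    have "\<bar>I p T / T - M\<bar> \<le> S / T + L * \<delta>" if T: "T > 0" for T
    proof -
      have contI: "continuous_on (cbox (0, 0) (1, 1)) (\<lambda>q. I q T)"
        unfolding I_def box_real[symmetric]
        by (rule integral_continuous_on_param)
           (auto simp: case_prod_unfold intro!: contc continuous_intros)
      have "norm (integral (cbox (0, 0) (1, 1 :: real)) (\<lambda>q. I p T - I q T))
          \<le> integral (cbox (0, 0) (1, 1 :: real)) (\<lambda>q :: real \<times> real. S + T * (L * \<delta>))"
        using close[OF T]
        by (intro integral_norm_bound_integral integrable_continuous continuous_intros contI) auto
      also have "integral (cbox (0, 0) (1, 1 :: real)) (\<lambda>q. I p T - I q T) = I p T - T * M"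
        by (subst integral_diff) (auto simp: mean[OF T] content_Pair intro!: integrable_continuous contI)
      finally have "\<bar>I p T - T * M\<bar> \<le> S + T * (L * \<delta>)"
        by (simp add: content_Pair)
      then have "\<bar>I p T - T * M\<bar> / T \<le> (S + T * (L * \<delta>)) / T"
        using T by (intro divide_right_mono) auto
      moreover have "\<bar>I p T - T * M\<bar> / T = \<bar>I p T / T - M\<bar>"
      proof -
        have "I p T / T - M = (I p T - T * M) / T"
          using T by (simp add: field_simps)
        then show ?thesis
          using T by simp
      qed
      ultimately show ?thesis
        using T by (simp add: add_divide_distrib)
    qed
    moreover have "S \<ge> 0"
      using a by (simp add: S_def)
    ultimately show ?thesis
      by blast
  qed
  have "((\<lambda>T. I p T / T) \<longlongrightarrow> M) at_top"
  proof (rule tendstoI)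
    fix \<epsilon> :: real assume "\<epsilon> > 0"
    \<comment> \<open>\<open>L + 1\<close> instead of \<open>L\<close> covers the case of a constant
      \<open>f\<close> with \<open>L = 0\<close>.\<close>
    define \<delta> where "\<delta> = \<epsilon> / (2 * (L + 1))"
    have "\<delta> > 0"
      using \<open>\<epsilon> > 0\<close> L0 by (simp add: \<delta>_def)
    then obtain S where S: "S \<ge> 0" "\<And>T. T > 0 \<Longrightarrow> \<bar>I p T / T - M\<bar> \<le> S / T + L * \<delta>"
      using key by blast
    have "L * \<delta> \<le> (L + 1) * \<delta>"
      using \<open>\<delta> > 0\<close> by simp
    also have "\<dots> = \<epsilon> / 2"
      using L0 by (simp add: \<delta>_def field_simps)
    finally have L\<delta>: "L * \<delta> \<le> \<epsilon> / 2" .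
    have "eventually (\<lambda>T. T > max 0 (2 * S / \<epsilon>)) at_top"
      by (rule eventually_gt_at_top)
    then show "eventually (\<lambda>T. dist (I p T / T) M < \<epsilon>) at_top"
    proof eventually_elim
      case (elim T)
      then have "S / T < \<epsilon> / 2"
        using \<open>\<epsilon> > 0\<close> by (auto simp: field_simps)
      moreover have "\<bar>I p T / T - M\<bar> \<le> S / T + L * \<delta>"
        using S(2) elim by simp
      ultimately show ?case
        using L\<delta> unfolding dist_real_def by linarith
    qed
  qed
  then show ?thesis
    by (simp add: I_def M_def w_def)
qed

section \<open>Visiting frequencies of periodic sets with negligible frontier\<close>

lemma infdist_translation_invariant:
  fixes F :: "'a::real_normed_vector set"
  assumes "\<And>p. p + z \<in> F \<longleftrightarrow> p \<in> F"
  shows "infdist (p + z) F = infdist p F"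
proof (cases "F = {}")
  case False
  have le: "infdist (q + y) F \<le> infdist q F" if "\<And>p. p \<in> F \<Longrightarrow> p + y \<in> F" for q y
  proof -
    have "infdist (q + y) F \<le> dist q a" if "a \<in> F" for a
      using infdist_le[of "a + y" F "q + y"] that \<open>\<And>p. p \<in> F \<Longrightarrow> p + y \<in> F\<close> by simp
    then show ?thesis
      using False by (subst (2) infdist_def) (auto intro!: cINF_greatest)
  qed
  have "p - z \<in> F" if "p \<in> F" for p
    using assms[of "p - z"] that by simp
  then show ?thesis
    using le[of z p] le[of "- z" "p + z"] assms by force
qed (simp add: infdist_def)

lemma lmeasurable_Int_Icc:
  fixes a b :: real
  assumes "X \<in> sets lebesgue"
  shows "X \<inter> {a..b} \<in> lmeasurable"
  using fmeasurable_Int_fmeasurable[of "{a..b}" lebesgue X] assms by (simp add: Int_commute)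

text \<open>The periodic Lipschitz functions \<open>h k\<close> majorise the indicator of
  \<open>F\<close> and decrease to that of its closure, so their integrals tend to the area of
  \<open>F\<close>, the frontier being null. Membership is linked to \<open>F\<close> only from
  \<open>t0\<close> on because a dissipative flow line follows the linear flow in this sense only
  once it is synchronised.\<close>

lemma linear_flow_frequency_upper:
  fixes F :: "(real \<times> real) set" and \<alpha> a :: real
  assumes irr: "\<alpha> \<notin> \<rat>" and a: "a > 0"
    and per: "\<And>p. p + (1, 0) \<in> F \<longleftrightarrow> p \<in> F" "\<And>p. p + (0, 1) \<in> F \<longleftrightarrow> p \<in> F"
    and neg: "negligible (frontier F)"
    and X: "X \<in> sets lebesgue" "\<And>t. t \<ge> t0 \<Longrightarrow> t \<in> X \<Longrightarrow> p + t *\<^sub>R (a, \<alpha> * a) \<in> F"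
    and "\<epsilon> > 0"
  shows "\<forall>\<^sub>F T in at_top. measure lebesgue (X \<inter> {0..T}) / T
           \<le> measure lebesgue (F \<inter> cbox (0, 0) (1, 1)) + \<epsilon>"
proof -
  define Q where "Q = cbox (0, 0) (1 :: real, 1 :: real)"
  define w where "w = (a, \<alpha> * a)"
  define s where "s = max 0 t0"
  have XT: "X \<inter> {0..T} \<in> lmeasurable" for T
    using X(1) by (rule lmeasurable_Int_Icc)
  show ?thesis
  proof (cases "F = {}")
    \<comment> \<open>The distance to the empty set is 0 by convention, so the majorants used below
      would be constantly 1.\<close>
    case True
    have "measure lebesgue (X \<inter> {0..T}) \<le> s" if "T > 0" for T
    proof -
      have "t < t0" if "t \<in> X" for t
        using X(2)[of t] True that by force
      then have "X \<inter> {0..T} \<subseteq> {0..s}"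
        by (force simp: s_def)
      then have "measure lebesgue (X \<inter> {0..T}) \<le> measure lebesgue {0..s}"
        using XT by (intro measure_mono_fmeasurable) auto
      then show ?thesis
        by (simp add: s_def)
    qed
    moreover have "\<forall>\<^sub>F T in at_top. T > max 0 (s / \<epsilon>)"
      by (rule eventually_gt_at_top)
    ultimately have "\<forall>\<^sub>F T in at_top. measure lebesgue (X \<inter> {0..T}) / T \<le> \<epsilon>"
    proof (elim eventually_mono)
      fix T assume T: "T > max 0 (s / \<epsilon>)" 
      assume "\<And>T. T > 0 \<Longrightarrow> measure lebesgue (X \<inter> {0..T}) \<le> s"
      with T have "measure lebesgue (X \<inter> {0..T}) \<le> s" "s < \<epsilon> * T" "T > 0"
        using \<open>\<epsilon> > 0\<close> by (auto simp: field_simps)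
      then show "measure lebesgue (X \<inter> {0..T}) / T \<le> \<epsilon>"
        by (simp add: field_simps)
    qed
    then show ?thesis
      using True by simp
  next
    case False
    define h where "h = (\<lambda>(k::nat) p. max 0 (1 - real k * infdist p F))"
    have bnd: "0 \<le> h k p \<and> h k p \<le> 1" for k p
      by (auto simp: h_def infdist_nonneg)
    have conth: "continuous_on S (h k)" for S k
      unfolding h_def by (intro continuous_intros)
    have lim: "(\<lambda>k. integral Q (h k)) \<longlonglongrightarrow> integral Q (indicat_real (closure F))"
    proof (rule dominated_convergence)
      show "h k integrable_on Q" for k
        unfolding Q_def by (intro integrable_continuous conth)
      show "(\<lambda>_. 1 :: real) integrable_on Q"
        unfolding Q_def by (rule integrable_const)
      show "norm (h k p) \<le> 1" for k p
        using bnd[of k p] by simp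
      show "(\<lambda>k. h k p) \<longlonglongrightarrow> indicat_real (closure F) p" for p
      proof (cases "p \<in> closure F")
        case True
        then show ?thesis
          using in_closure_iff_infdist_zero[OF False] by (simp add: h_def)
      next
        case out: False
        then have pos: "infdist p F > 0"
          using in_closure_iff_infdist_zero[OF False, of p] infdist_nonneg[of p F] by (simp add: less_le)
        obtain n :: nat where n: "1 < real n * infdist p F"
          using ex_less_of_nat_mult[OF pos] by blast
        have "h k p = 0" if "k \<ge> n" for k
        proof -
          have "real n * infdist p F \<le> real k * infdist p F"
            using that pos by (intro mult_right_mono) auto
          then show ?thesis
            using n by (simp add: h_def)
        qed
        then have "\<forall>\<^sub>F k in sequentially. h k p = 0"
          by (auto simp: eventually_sequentially)
        then show ?thesis
          using out by (simp add: tendsto_eventually)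
      qed
    qed
    have "integral Q (indicat_real (closure F)) = measure lebesgue (closure F \<inter> Q)"
      by (intro integral_indicator lmeasurable_compact closed_Int_compact) (auto simp: Q_def)
    also have "\<dots> = measure lebesgue (F \<inter> Q)"
    proof (rule measure_negligible_symdiff)
      have sub: "F \<inter> Q - closure F \<inter> Q \<union> (closure F \<inter> Q - F \<inter> Q) \<subseteq> frontier F"
        using closure_subset[of F] interior_subset[of F] by (auto simp: frontier_def)
      show "negligible (F \<inter> Q - closure F \<inter> Q \<union> (closure F \<inter> Q - F \<inter> Q))"
        by (rule negligible_subset[OF neg sub])
      have "frontier (F \<inter> Q) \<subseteq> frontier F \<union> frontier Q"
        by (rule frontier_Int_subset)
      moreover have "negligible (frontier Q)"
        by (simp add: Q_def negligible_convex_frontier)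
      ultimately have "negligible (frontier (F \<inter> Q))"
        using neg by (meson negligible_Un negligible_subset)
      then show "F \<inter> Q \<in> lmeasurable"
        by (intro measurable_Jordan) (auto simp: Q_def)
    qed
    finally have "\<forall>\<^sub>F k in sequentially. integral Q (h k) < measure lebesgue (F \<inter> Q) + \<epsilon> / 3"
      using lim \<open>\<epsilon> > 0\<close> by (intro order_tendstoD(2)[OF lim]) simp
    then obtain k where k: "integral Q (h k) < measure lebesgue (F \<inter> Q) + \<epsilon> / 3"
      by (auto simp: eventually_sequentially)
    have "((\<lambda>T. integral {0..T} (\<lambda>t. h k (p + t *\<^sub>R (a, \<alpha> * a))) / T) \<longlongrightarrow> integral (cbox (0, 0) (1, 1)) (h k)) at_top"
    proof (rule linear_flow_average[OF irr a])
      fix p q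
      have "\<bar>h k p - h k q\<bar> \<le> \<bar>real k * infdist p F - real k * infdist q F\<bar>"
        by (auto simp: h_def)
      also have "\<dots> = real k * \<bar>infdist p F - infdist q F\<bar>"
        by (simp add: abs_mult flip: right_diff_distrib)
      also have "\<dots> \<le> real k * dist p q"
        using infdist_triangle_abs[of p F q] by (intro mult_left_mono) auto
      finally show "\<bar>h k p - h k q\<bar> \<le> real k * dist p q" .
      show "h k (p + (1, 0)) = h k p" "h k (p + (0, 1)) = h k p"
        using infdist_translation_invariant[OF per(1)] infdist_translation_invariant[OF per(2)]
        by (simp_all add: h_def)
    qed (rule bnd)
    then have "\<forall>\<^sub>F T in at_top. integral {0..T} (\<lambda>t. h k (p + t *\<^sub>R w)) / T < integral Q (h k) + \<epsilon> / 3"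
      using \<open>\<epsilon> > 0\<close> by (intro order_tendstoD(2)) (auto simp: w_def Q_def)
    \<comment> \<open>One third of \<epsilon> pays for the initial segment \<open>{0..s}\<close>;
      the other two pay for the choice of \<open>k\<close> and for the convergence of the time
      averages of \<open>h k\<close>.\<close>
    moreover have "\<forall>\<^sub>F T in at_top. T > max s (3 * s / \<epsilon>)"
      by (rule eventually_gt_at_top)
    ultimately show ?thesis
    proof eventually_elim
      case (elim T)
      have T: "T > 0" "T > s" "s / T < \<epsilon> / 3"
        using elim(2) \<open>\<epsilon> > 0\<close> by (auto simp: s_def field_simps)
      have inth: "(\<lambda>t. h k (p + t *\<^sub>R w)) integrable_on {x..y}" for x y
        by (intro integrable_continuous_interval continuous_on_compose2[OF conth[of UNIV]] continuous_intros) auto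
      have intX: "indicat_real X integrable_on {x..y}" for x y
        using X(1) unfolding integrable_on_indicator by (rule lmeasurable_Int_Icc)
      have "measure lebesgue (X \<inter> {0..T}) = integral {0..T} (indicat_real X)"
        by (intro integral_indicator[symmetric] XT)
      also have "\<dots> = integral {0..s} (indicat_real X) + integral {s..T} (indicat_real X)"
        using T intX by (intro Henstock_Kurzweil_Integration.integral_combine[symmetric]) (auto simp: s_def)
      also have "integral {0..s} (indicat_real X) \<le> integral {0..s} (\<lambda>_. 1)"
        by (intro integral_le intX) (auto simp: indicator_def)
      also have "integral {0..s} (\<lambda>_. 1 :: real) = s"
        by (simp add: s_def)
      also have "integral {s..T} (indicat_real X) \<le> integral {s..T} (\<lambda>t. h k (p + t *\<^sub>R w))"
      proof (intro integral_le intX inth)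
        fix t assume t: "t \<in> {s..T}"
        show "indicat_real X t \<le> h k (p + t *\<^sub>R w)"
        proof (cases "t \<in> X")
          case True
          then have "p + t *\<^sub>R w \<in> F"
            using X(2)[of t] t by (simp add: s_def w_def)
          then show ?thesis
            by (simp add: h_def)
        qed (use bnd in auto)
      qed
      also have "integral {s..T} (\<lambda>t. h k (p + t *\<^sub>R w)) \<le> integral {0..T} (\<lambda>t. h k (p + t *\<^sub>R w))"
        using bnd by (intro integral_subset_le inth) (auto simp: s_def)
      finally have "measure lebesgue (X \<inter> {0..T}) / T \<le> (s + integral {0..T} (\<lambda>t. h k (p + t *\<^sub>R w))) / T"
        using T by (simp add: divide_right_mono)
      also have "\<dots> \<le> measure lebesgue (F \<inter> Q) + \<epsilon>"
        using T elim(1) k unfolding add_divide_distrib by linarith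
      finally show ?case
        by (simp add: Q_def)
    qed
  qed
qed

text \<open>The lower bound is the upper bound for the complements of \<open>F\<close> and
  \<open>X\<close>; a set and its complement have the same frontier.\<close>

lemma linear_flow_frequency:
  fixes F :: "(real \<times> real) set" and \<alpha> a :: real
  assumes irr: "\<alpha> \<notin> \<rat>" and a: "a > 0"
    and per: "\<And>p. p + (1, 0) \<in> F \<longleftrightarrow> p \<in> F" "\<And>p. p + (0, 1) \<in> F \<longleftrightarrow> p \<in> F"
    and neg: "negligible (frontier F)"
    and X: "X \<in> sets lebesgue" "\<And>t. t \<ge> t0 \<Longrightarrow> t \<in> X \<longleftrightarrow> p + t *\<^sub>R (a, \<alpha> * a) \<in> F"
  shows "((\<lambda>T. measure lebesgue (X \<inter> {0..T}) / T)
           \<longlongrightarrow> measure lebesgue (F \<inter> cbox (0, 0) (1, 1))) at_top"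
proof (rule tendstoI)
  fix \<epsilon> :: real assume "\<epsilon> > 0"
  define Q where "Q = cbox (0, 0) (1 :: real, 1 :: real)"
  have "frontier (F \<inter> Q) \<subseteq> frontier F \<union> frontier Q"
    by (rule frontier_Int_subset)
  moreover have "negligible (frontier Q)"
    by (simp add: Q_def negligible_convex_frontier)
  ultimately have "negligible (frontier (F \<inter> Q))"
    using neg by (meson negligible_Un negligible_subset)
  then have FQ: "F \<inter> Q \<in> lmeasurable"
    by (intro measurable_Jordan) (auto simp: Q_def)
  have "Q - F \<inter> Q = - F \<inter> Q"
    by auto
  moreover have "measure lebesgue (Q - F \<inter> Q) = measure lebesgue Q - measure lebesgue (F \<inter> Q)"
    using FQ by (intro measurable_measure_Diff) (auto simp: Q_def)
  ultimately have cF: "measure lebesgue (- F \<inter> Q) = 1 - measure lebesgue (F \<inter> Q)"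
    by (simp add: Q_def content_Pair)
  have "\<forall>\<^sub>F T in at_top. measure lebesgue (X \<inter> {0..T}) / T \<le> measure lebesgue (F \<inter> Q) + \<epsilon> / 2"
    unfolding Q_def using X \<open>\<epsilon> > 0\<close>
    by (intro linear_flow_frequency_upper[OF irr a per neg, where ?t0.0 = t0 and p = p]) auto
  moreover have "\<forall>\<^sub>F T in at_top. measure lebesgue (- X \<inter> {0..T}) / T \<le> measure lebesgue (- F \<inter> Q) + \<epsilon> / 2"
    unfolding Q_def using X \<open>\<epsilon> > 0\<close> per neg
    by (intro linear_flow_frequency_upper[OF irr a, where ?t0.0 = t0 and p = p])
       (auto simp: frontier_complement Compl_in_sets_lebesgue)
  moreover have "\<forall>\<^sub>F T :: real in at_top. T > 0"
    by (rule eventually_gt_at_top)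
  ultimately show "\<forall>\<^sub>F T in at_top. dist (measure lebesgue (X \<inter> {0..T}) / T)
      (measure lebesgue (F \<inter> cbox (0, 0) (1, 1))) < \<epsilon>"
  proof eventually_elim
    case (elim T)
    have XT: "X \<inter> {0..T} \<in> lmeasurable"
      using X(1) by (rule lmeasurable_Int_Icc)
    have "{0..T} - X \<inter> {0..T} = - X \<inter> {0..T}"
      by auto
    moreover have "measure lebesgue ({0..T} - X \<inter> {0..T}) = measure lebesgue {0..T} - measure lebesgue (X \<inter> {0..T})"
      using XT by (intro measurable_measure_Diff) auto
    ultimately have "measure lebesgue (- X \<inter> {0..T}) = T - measure lebesgue (X \<inter> {0..T})"
      using elim(3) by simp
    then have "measure lebesgue (- X \<inter> {0..T}) / T = 1 - measure lebesgue (X \<inter> {0..T}) / T"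
      using elim(3) by (simp add: diff_divide_distrib)
    then show ?case
      using elim cF \<open>\<epsilon> > 0\<close> unfolding Q_def[symmetric] dist_real_def by linarith
  qed
qed

subsection \<open>The synchronised square\<close>

lemma frac_eq_iff_diff_Ints: "frac x = frac y \<longleftrightarrow> x - y \<in> \<int>" for x y :: real
proof
  assume "x - y \<in> \<int>"
  then obtain k where "x = y + of_int k"
    by (metis Ints_cases add.commute diff_add_cancel)
  then show "frac x = frac y"
    by simp
next
  assume "frac x = frac y"
  then have "x - y = of_int (\<lfloor>x\<rfloor> - \<lfloor>y\<rfloor>)"
    by (simp add: frac_def)
  then show "x - y \<in> \<int>"
    by (metis Ints_of_int)
qed

lemma interval_contains_Icc:
  fixes I :: "real set"
  assumes "is_interval I" and "measure lborel I > 0"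
  obtains c d where "c < d" "{c..d} \<subseteq> I"
proof -
  have "\<not> I \<subseteq> {x}" for x
  proof
    assume "I \<subseteq> {x}"
    then have "I = {} \<or> I = {x}"
      by auto
    then show False
      using assms(2) by auto
  qed
  then obtain x y where "x \<in> I" "y \<in> I" "x < y"
    by (metis all_not_in_conv empty_subsetI insertCI less_linear singletonD subsetI)
  then show ?thesis
    using that assms(1) by (meson atLeastAtMost_iff mem_is_interval_1_I subsetI)
qed

locale barrier_flow =
  fixes \<alpha> :: real and J :: "real set"
  assumes alpha_pos: "\<alpha> > 0" and alpha_irrational: "\<alpha> \<notin> \<rat>"
    and intervals: "finite_interval_union J"
begin

definition speed :: real where
  "speed = sqrt (1 + \<alpha>\<^sup>2)"

definition blocked :: "real \<Rightarrow> bool" where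
  "blocked y \<longleftrightarrow> frac y \<in> J"

text \<open>The height, not reduced modulo 1, at which the line of slope \<alpha> through
  \<open>p\<close> meets the left edge of its square.\<close>

definition base :: "real \<times> real \<Rightarrow> real" where
  "base p = snd p - \<alpha> * frac (fst p)"

text \<open>The square that is entered at the \<open>k\<close>-th vertical edge by the flow line that starts in square
  \<open>i\<close> and, prolonged backwards, meets the left edge of this square at height \<open>y\<close>.\<close>

primrec state :: "real \<Rightarrow> int \<Rightarrow> nat \<Rightarrow> int" where
  "state y i 0 = i"
| "state y i (Suc k) = (if blocked (y + real (Suc k) * \<alpha>) then 0 else 1 - state y i k)"

text \<open>Every flow line is in square 0 after meeting a height in \<open>J\<close>, and otherwise changes the
  square at each edge. Hence in the long run the square depends on the height only: it is the parity
  of the time since the last visit to \<open>J\<close>.\<close>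

definition sync :: "real \<Rightarrow> int" where
  "sync y = int ((LEAST n. blocked (y - real n * \<alpha>)) mod 2)"

text \<open>Taking the parity makes the condition meaningful on the whole plane and invariant under
  the lattice of the torus, so that it can be studied with the topology of the plane.\<close>

definition synced :: "real \<times> real \<Rightarrow> bool" where
  "synced p \<longleftrightarrow> \<lfloor>fst p\<rfloor> mod 2 = sync (base p)"

definition attractor :: "(real \<times> real) set" where
  "attractor = {p \<in> torus. synced p}"

lemma speed_pos: "speed > 0"
  by (simp add: speed_def add_pos_nonneg)

lemma blocked_add_int [simp]: "blocked (y + of_int k) \<longleftrightarrow> blocked y"
  by (simp add: blocked_def)

lemma blocked_diff_int: "x - y \<in> \<int> \<Longrightarrow> blocked x \<longleftrightarrow> blocked y"
  using frac_eq_iff_diff_Ints[of x y] by (simp add: blocked_def)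

lemma J_subset: "J \<subseteq> {0..<1}"
  using intervals by (auto simp: finite_interval_union_def)

text \<open>\<open>J\<close> contains some \<open>{c..d}\<close> with midpoint \<open>m\<close>.
  Rotating \<open>m - y\<close> forwards until it is within half the length of an integer rotates
  \<open>y\<close> backwards into this interval modulo 1.\<close>

lemma bounded_blocked: "\<exists>N. \<forall>y. \<exists>n\<le>N. blocked (y - real n * \<alpha>)"
proof -
  obtain I where "is_interval I" "measure lborel I > 0" "I \<subseteq> J"
    using intervals by (auto simp: finite_interval_union_def)
  then obtain c d where cd: "c < d" "{c..d} \<subseteq> J"
    using interval_contains_Icc by (metis subset_trans)
  define m where "m = (c + d) / 2"
  obtain N :: nat where N: "\<And>y. \<exists>n\<le>N. \<exists>k::int. \<bar>y + real n * \<alpha> - of_int k\<bar> < (d - c) / 2"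
    using rotation_bounded_dense[OF alpha_irrational, of "(d - c) / 2"] cd(1) by auto
  have "\<exists>n\<le>N. blocked (y - real n * \<alpha>)" for y
  proof -
    obtain n k where n: "n \<le> N" and k: "\<bar>m - y + real n * \<alpha> - of_int k\<bar> < (d - c) / 2"
      using N by blast
    define z where "z = y - real n * \<alpha> + of_int k"
    have "z \<in> {c..d}"
      using k by (auto simp: z_def m_def abs_less_iff field_simps)
    then have "z \<in> J" "0 \<le> z" "z < 1"
      using cd(2) J_subset by force+
    then have "blocked z"
      by (simp add: blocked_def frac_eq)
    then show ?thesis
      using n by (auto simp: z_def)
  qed
  then show ?thesis
    by blast
qed

definition sync_steps :: nat where
  "sync_steps = (SOME N. \<forall>y. \<exists>n\<le>N. blocked (y - real n * \<alpha>))"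

lemma sync_steps: "\<exists>n\<le>sync_steps. blocked (y - real n * \<alpha>)"
  unfolding sync_steps_def using someI_ex[OF bounded_blocked] by blast

text \<open>This is the recursion of \<open>state\<close> along an orbit of the rotation. Hence the
  two agree forever once they agree.\<close>

lemma sync_rec: "sync y = (if blocked y then 0 else 1 - sync (y - \<alpha>))"
proof (cases "blocked y")
  case True
  then have "(LEAST n. blocked (y - real n * \<alpha>)) = 0"
    by (intro Least_equality) auto
  then show ?thesis
    using True by (simp add: sync_def)
next
  case False
  obtain n where "blocked (y - real n * \<alpha>)"
    using sync_steps by blast
  then have "(LEAST n. blocked (y - real n * \<alpha>)) = Suc (LEAST n. blocked (y - real (Suc n) * \<alpha>))"
    using False by (intro Least_Suc) auto
  also have "(\<lambda>n. blocked (y - real (Suc n) * \<alpha>)) = (\<lambda>n. blocked (y - \<alpha> - real n * \<alpha>))"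
    by (simp add: algebra_simps)
  finally have "sync y = 1 - sync (y - \<alpha>)"
    by (simp add: sync_def mod_Suc)
  then show ?thesis
    using False by simp
qed

lemma sync_cases: "sync y = 0 \<or> sync y = 1"
  by (simp add: sync_def) linarith

lemma sync_diff_int: "x - y \<in> \<int> \<Longrightarrow> sync x = sync y"
proof -
  assume "x - y \<in> \<int>"
  then have "blocked (x - real n * \<alpha>) \<longleftrightarrow> blocked (y - real n * \<alpha>)" for n
    by (intro blocked_diff_int) simp
  then show ?thesis
    by (simp add: sync_def)
qed

text \<open>The most recent visit to \<open>J\<close> is at most \<open>sync_steps\<close> steps
  old, so these heights alone determine it. This is what leaves only finitely many places modulo 1
  where \<open>sync\<close> can change.\<close>

lemma sync_cong:
  assumes "\<And>n. n \<le> sync_steps \<Longrightarrow> blocked (y - real n * \<alpha>) \<longleftrightarrow> blocked (z - real n * \<alpha>)"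
  shows "sync y = sync z"
proof -
  obtain n where n: "n \<le> sync_steps" "blocked (y - real n * \<alpha>)"
    using sync_steps by blast
  define m where "m = (LEAST n. blocked (y - real n * \<alpha>))"
  have m: "blocked (y - real m * \<alpha>)" "m \<le> n"
    unfolding m_def using n(2) by (auto intro: LeastI Least_le)
  have "(LEAST n. blocked (z - real n * \<alpha>)) = m"
  proof (rule Least_equality)
    show "blocked (z - real m * \<alpha>)"
      using m n assms by auto
    fix k assume "blocked (z - real k * \<alpha>)"
    then show "m \<le> k"
      using m n assms[of k] unfolding m_def by (metis Least_le le_cases order_trans)
  qed
  then show ?thesis
    by (simp add: sync_def m_def)
qed

lemma state_cases: "i \<in> {0, 1} \<Longrightarrow> state y i k \<in> {0, 1}"
  by (induction k) auto

text \<open>Restarts the recursion at the next edge. The new height is given only modulo 1 since the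
  flow reduces it.\<close>

lemma state_shift:
  assumes "z - (y + \<alpha>) \<in> \<int>"
  shows "state z (state y i 1) k = state y i (Suc k)"
proof (induction k)
  case (Suc k)
  have "blocked (z + real (Suc k) * \<alpha>) \<longleftrightarrow> blocked (y + real (Suc (Suc k)) * \<alpha>)"
    using assms by (intro blocked_diff_int) (simp add: algebra_simps)
  then show ?case
    using Suc by simp
qed simp

lemma state_stays_synced:
  assumes "state y i k = sync (y + real k * \<alpha>)" and "k \<le> m"
  shows "state y i m = sync (y + real m * \<alpha>)"
  using assms(2)
proof (induction rule: dec_induct)
  case (step n)
  then show ?case
    using sync_rec[of "y + real (Suc n) * \<alpha>"] by (simp add: algebra_simps)
qed (rule assms(1))

text \<open>One of the last \<open>sync_steps + 1\<close> heights is in \<open>J\<close> modulo 1,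
  and there both sides are 0. Strictness of the bound keeps this visit at an index of at least 1: at
  index 0, \<open>state\<close> is the starting square, whatever the height.\<close>

lemma state_eventually_synced:
  assumes "k > sync_steps"
  shows "state y i k = sync (y + real k * \<alpha>)"
proof -
  obtain n where n: "n \<le> sync_steps" "blocked (y + real k * \<alpha> - real n * \<alpha>)"
    using sync_steps by blast
  define m where "m = k - n"
  have m: "m > 0" "m \<le> k"
    using n assms by (auto simp: m_def)
  have "blocked (y + real m * \<alpha>)"
    using n assms by (simp add: m_def of_nat_diff algebra_simps)
  moreover from this have "state y i m = 0"
    using m(1) by (metis gr0_implies_Suc state.simps(2))
  moreover have "sync (y + real m * \<alpha>) = 0"
    using sync_rec[of "y + real m * \<alpha>"] \<open>blocked (y + real m * \<alpha>)\<close> by simp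
  ultimately have "state y i m = sync (y + real m * \<alpha>)"
    by simp
  then show ?thesis
    using m(2) by (rule state_stays_synced)
qed

section \<open>Closed form of the dissipative flow and synchronisation\<close>

lemma torus_floor: "p \<in> torus \<Longrightarrow> \<lfloor>fst p\<rfloor> \<in> {0, 1}"
  by (auto simp: torus_def floor_eq_iff)

abbreviation flow :: "real \<Rightarrow> real \<times> real \<Rightarrow> real \<times> real" where
  "flow \<equiv> dissipative_flow \<alpha> J"

text \<open>The number of vertical edges met up to time \<open>t\<close>. The undisturbed abscissa
  can be used because wrapping around and being sent back by the barrier both change it by an
  integer.\<close>

definition crossings :: "real \<Rightarrow> real \<times> real \<Rightarrow> nat" where
  "crossings t p = nat (\<lfloor>fst p + t / speed\<rfloor> - \<lfloor>fst p\<rfloor>)"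

text \<open>The one rule of \<open>state\<close> fits both squares: from square 1 the line enters
  square 0 whether or not the height is in \<open>J\<close>, just as \<open>state\<close>
  prescribes.\<close>

lemma edge_hit_eq:
  assumes "p \<in> torus"
  shows "edge_hit \<alpha> J p = (of_int (state (base p) \<lfloor>fst p\<rfloor> 1), frac (base p + \<alpha>))"
proof -
  define i where "i = \<lfloor>fst p\<rfloor>"
  have i: "i \<in> {0, 1}"
    using torus_floor[OF assms] by (simp add: i_def)
  have "edge_time \<alpha> p / sqrt (1 + \<alpha>\<^sup>2) = of_int (i + 1) - fst p"
    using speed_pos by (simp add: edge_time_def i_def speed_def)
  then have "straight_flow \<alpha> (edge_time \<alpha> p) p
      = (2 * frac (of_int (i + 1) / 2), frac (snd p + (of_int (i + 1) - fst p) * \<alpha>))"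
    by (simp add: straight_flow_def torus_proj_def)
  also have "snd p + (of_int (i + 1) - fst p) * \<alpha> = base p + \<alpha>"
    by (simp add: base_def frac_def i_def algebra_simps)
  also have "2 * frac (of_int (i + 1) / 2) = (of_int (1 - i) :: real)"
    using i by (auto simp: frac_def)
  finally show ?thesis
    using i by (auto simp: edge_hit_def jump_def barrier_def blocked_def i_def[symmetric])
qed

text \<open>Modulo 1 both coordinates follow the linear flow; the barrier acts only on the integer
  part of the abscissa. The induction peels off one edge at a time, which \<open>state_shift\<close>
  matches.\<close>

lemma flow_eq:
  assumes "p \<in> torus" and "t \<ge> 0"
  shows "flow t p = (of_int (state (base p) \<lfloor>fst p\<rfloor> (crossings t p)) + frac (fst p + t / speed),
                     frac (snd p + \<alpha> * (t / speed)))"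
  using assms
proof (induction "crossings t p" arbitrary: t p)
  case 0
  define x where "x = fst p + t / speed"
  have "\<lfloor>fst p\<rfloor> \<le> \<lfloor>x\<rfloor>"
    using 0 speed_pos by (simp add: x_def floor_mono)
  then have fl: "\<lfloor>x\<rfloor> = \<lfloor>fst p\<rfloor>"
    using 0 by (simp add: crossings_def x_def)
  then have "x < of_int (\<lfloor>fst p\<rfloor> + 1)"
    by linarith
  then have "t < edge_time \<alpha> p"
    using speed_pos by (simp add: x_def edge_time_def speed_def field_simps)
  moreover have "\<lfloor>x\<rfloor> \<in> {0, 1}"
    using fl torus_floor[OF 0(2)] by simp
  then have "0 \<le> x / 2" "x / 2 < 1"
    by auto linarith+
  then have "2 * frac (x / 2) = x"
    by (simp add: frac_eq)
  moreover have "x = of_int \<lfloor>fst p\<rfloor> + frac x"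
    using fl by (simp add: frac_def)
  ultimately show ?case
    using 0(1) 
    by (simp add: dissipative_flow.simps[of \<alpha> J t p] straight_flow_def torus_proj_def x_def
        speed_def[symmetric] mult.commute flip: 0(1))
next
  case (Suc n)
  define i where "i = \<lfloor>fst p\<rfloor>"
  define x where "x = fst p + t / speed"
  define t' where "t' = t - edge_time \<alpha> p"
  define p' where "p' = edge_hit \<alpha> J p"
  have "\<lfloor>x\<rfloor> = i + int (Suc n)"
    using Suc(2) by (simp add: crossings_def x_def i_def)
  then have "of_int (i + 1) \<le> x"
    by linarith
  then have late: "\<not> t < edge_time \<alpha> p"
    using speed_pos by (simp add: x_def edge_time_def speed_def i_def field_simps)
  have p': "p' = (of_int (state (base p) i 1), frac (base p + \<alpha>))"
    using edge_hit_eq[OF Suc.prems(1)] by (simp add: p'_def i_def)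
  have "state (base p) i 1 \<in> {0, 1}"
    using state_cases torus_floor[OF Suc.prems(1)] unfolding i_def by blast
  then have torus': "p' \<in> torus"
    unfolding p' torus_def using frac_lt_1 by auto
  have t'_speed: "t' / speed = t / speed - (of_int (i + 1) - fst p)"
    using speed_pos by (simp add: t'_def edge_time_def speed_def i_def diff_divide_distrib)
  then have x': "fst p' + t' / speed = x + of_int (state (base p) i 1 - (i + 1))"
    by (simp add: p' x_def)
  have "\<lfloor>fst p' + t' / speed\<rfloor> - \<lfloor>fst p'\<rfloor> = int n"
    unfolding x' floor_add_int[symmetric] using \<open>\<lfloor>x\<rfloor> = i + int (Suc n)\<close> by (simp add: p')
  then have n: "crossings t' p' = n"
    by (simp add: crossings_def)
  have "flow t p = flow t' p'"
    using late by (simp add: dissipative_flow.simps[of \<alpha> J t p] t'_def p'_def)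
  also have "\<dots> = (of_int (state (base p') \<lfloor>fst p'\<rfloor> n) + frac (fst p' + t' / speed),
                     frac (snd p' + \<alpha> * (t' / speed)))"
    using Suc(1)[of t' p'] n torus' late by (simp add: t'_def)
  also have "state (base p') \<lfloor>fst p'\<rfloor> n = state (base p) i (Suc n)"
    using state_shift[of "base p'" "base p" i n]
    by (simp add: p' base_def frac_def)
  also have "frac (fst p' + t' / speed) = frac x"
    unfolding x' by (simp only: frac_add_of_int_right)
  also have "frac (snd p' + \<alpha> * (t' / speed)) = frac (snd p + \<alpha> * (t / speed))"
    unfolding frac_eq_iff_diff_Ints t'_speed
    by (simp add: p' base_def frac_def i_def algebra_simps)
  finally show ?case
    using Suc(2) by (simp add: x_def i_def)
qed

lemma flow_congruent:
  assumes "p \<in> torus" and "t \<ge> 0"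
  shows "fst (flow t p) - (fst p + t / speed) \<in> \<int>"
    and "snd (flow t p) - (snd p + \<alpha> * (t / speed)) \<in> \<int>"
  by (simp_all add: flow_eq[OF assms] frac_def)

lemma flow_in_torus:
  assumes "p \<in> torus" and "t \<ge> 0"
  shows "flow t p \<in> torus"
  using state_cases[OF torus_floor[OF assms(1)], of "base p" "crossings t p"]
    frac_lt_1[of "fst p + t / speed"] frac_lt_1[of "snd p + \<alpha> * (t / speed)"]
  by (auto simp: flow_eq[OF assms] torus_def simp del: frac_lt_1)

lemma base_flow_congruent:
  assumes "p \<in> torus" and "t \<ge> 0"
  shows "base (flow t p) - (base p + real (crossings t p) * \<alpha>) \<in> \<int>"
proof -
  have "\<lfloor>fst p\<rfloor> \<le> \<lfloor>fst p + t / speed\<rfloor>"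
    using assms speed_pos by (intro floor_mono) simp
  then have "real (crossings t p) = of_int \<lfloor>fst p + t / speed\<rfloor> - of_int \<lfloor>fst p\<rfloor>"
    by (simp add: crossings_def)
  moreover have "frac (fst (flow t p)) = frac (fst p + t / speed)"
    by (simp add: flow_eq[OF assms])
  ultimately have frac_flow: "frac (fst (flow t p))
      = fst p + t / speed - of_int \<lfloor>fst p\<rfloor> - real (crossings t p)"
    by (simp add: frac_def)
  have "base (flow t p) - (base p + real (crossings t p) * \<alpha>)
      = snd (flow t p) - (snd p + \<alpha> * (t / speed))"
    unfolding base_def frac_flow by (simp add: frac_def algebra_simps)
  then show ?thesis
    using flow_congruent(2)[OF assms] by simp
qed

lemma synced_flow_iff:
  assumes "p \<in> torus" and "t \<ge> 0"
  shows "synced (flow t p) \<longleftrightarrow>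
    state (base p) \<lfloor>fst p\<rfloor> (crossings t p) = sync (base p + real (crossings t p) * \<alpha>)"
proof -
  have "\<lfloor>fst (flow t p)\<rfloor> = state (base p) \<lfloor>fst p\<rfloor> (crossings t p)"
    using frac_lt_1 by (simp add: flow_eq[OF assms] floor_eq_iff)
  moreover have "state (base p) \<lfloor>fst p\<rfloor> (crossings t p) \<in> {0, 1}"
    using state_cases torus_floor[OF assms(1)] by blast
  ultimately show ?thesis
    using sync_diff_int[OF base_flow_congruent[OF assms]] by (auto simp: synced_def)
qed

lemma flow_attractor:
  assumes "p \<in> attractor" and "t \<ge> 0"
  shows "flow t p \<in> attractor"
proof -
  have p: "p \<in> torus" "\<lfloor>fst p\<rfloor> = sync (base p)"
    using assms torus_floor[of p] by (auto simp: attractor_def synced_def)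
  then have "synced (flow t p)"
    using state_stays_synced[of "base p" "\<lfloor>fst p\<rfloor>" 0 "crossings t p"] assms(2)
    by (simp add: synced_flow_iff)
  then show ?thesis
    using flow_in_torus[OF p(1) assms(2)] by (simp add: attractor_def)
qed

text \<open>A horizontal unit takes time \<open>speed\<close>; within \<open>sync_steps + 2\<close>
  of them every flow line meets more than \<open>sync_steps\<close> vertical edges.\<close>

definition sync_time :: real where
  "sync_time = (real sync_steps + 2) * speed"

lemma sync_time_nonneg: "sync_time \<ge> 0"
  using speed_pos by (simp add: sync_time_def)

lemma flow_eventually_attractor:
  assumes "p \<in> torus" and "t \<ge> sync_time"
  shows "flow t p \<in> attractor"
proof -
  have t: "t \<ge> 0"
    using assms(2) sync_time_nonneg by simp
  have "real sync_steps + 2 \<le> t / speed"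
    using assms(2) speed_pos by (simp add: sync_time_def field_simps)
  then have "crossings t p > sync_steps"
    unfolding crossings_def by linarith
  then have "synced (flow t p)"
    using synced_flow_iff[OF assms(1) t] state_eventually_synced by blast
  then show ?thesis
    using flow_in_torus[OF assms(1) t] by (simp add: attractor_def)
qed

text \<open>Injectivity of the projection to the unit torus: the residues determine
  \<open>base\<close> on the torus, and \<open>sync\<close> of it determines the square. From here
  on, points of the attractor are identified by congruences alone.\<close>

lemma attractor_unique:
  assumes "p \<in> attractor" "q \<in> attractor" and "fst p - fst q \<in> \<int>" "snd p - snd q \<in> \<int>"
  shows "p = q"
proof -
  have fx: "frac (fst p) = frac (fst q)" and fy: "frac (snd p) = frac (snd q)"
    using assms by (simp_all add: frac_eq_iff_diff_Ints)
  have t: "p \<in> torus" "q \<in> torus"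
    using assms by (auto simp: attractor_def)
  then have "snd p = snd q"
    using fy by (auto simp: torus_def frac_eq)
  then have "base p = base q"
    using fx by (simp add: base_def)
  moreover have "\<lfloor>fst p\<rfloor> = sync (base p)" "\<lfloor>fst q\<rfloor> = sync (base q)"
    using assms t[THEN torus_floor] by (auto simp: attractor_def synced_def)
  ultimately have "fst p = fst q"
    using fx by (simp add: frac_def)
  then show ?thesis
    using \<open>snd p = snd q\<close> by (simp add: prod_eq_iff)
qed

end

subsection \<open>Polygons and the quotient topology\<close>

text \<open>The flow segments across square \<open>i\<close> that start at heights in
  \<open>{c..d}\<close> on its left edge, continued beyond height 1 without a horizontal
  cut.\<close>

definition parallelogram :: "real \<Rightarrow> int \<Rightarrow> real \<Rightarrow> real \<Rightarrow> (real \<times> real) set" where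
  "parallelogram \<alpha> i c d =
     {p. fst p \<in> {of_int i..of_int i + 1} \<and> snd p - \<alpha> * (fst p - of_int i) \<in> {c..d}}"

lemma parallelogram_polytope: "polytope (parallelogram \<alpha> i c d)"
proof -
  define f where "f = (\<lambda>p :: real \<times> real. (fst p, snd p + \<alpha> * fst p))"
  have "parallelogram \<alpha> i c d = (+) (of_int i, 0) ` f ` cbox (0, c) (1, d)"
  proof (intro set_eqI iffI)
    fix p assume p: "p \<in> parallelogram \<alpha> i c d"
    show "p \<in> (+) (of_int i, 0) ` f ` cbox (0, c) (1, d)"
      using p by (intro image_eqI[of _ _ "f (fst p - of_int i, snd p - \<alpha> * (fst p - of_int i))"] imageI)
        (auto simp: parallelogram_def f_def prod_eq_iff cbox_Pair_iff)
  qed (auto simp: parallelogram_def f_def cbox_Pair_iff algebra_simps)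
  moreover have "linear f"
    unfolding f_def by (rule linearI) (auto simp: algebra_simps prod_eq_iff)
  ultimately show ?thesis
    by (simp add: polytope_translation_eq polytope_linear_image polytope_interval)
qed

lemma parallelogram_aff_dim:
  assumes "c < d"
  shows "aff_dim (parallelogram \<alpha> i c d) = 2"
proof -
  define U where "U = {p :: real \<times> real. of_int i < fst p \<and> fst p < of_int i + 1
      \<and> c < snd p - \<alpha> * (fst p - of_int i) \<and> snd p - \<alpha> * (fst p - of_int i) < d}"
  have "open U"
    unfolding U_def by (intro open_Collect_conj open_Collect_less continuous_intros)
  moreover have "U \<subseteq> parallelogram \<alpha> i c d"
    by (auto simp: U_def parallelogram_def)
  moreover have "(of_int i + 1 / 2, (c + d) / 2 + \<alpha> * (1 / 2)) \<in> U"
    using assms by (auto simp: U_def field_simps)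
  ultimately have "interior (parallelogram \<alpha> i c d) \<noteq> {}"
    by (metis empty_iff interior_maximal subset_empty)
  then show ?thesis
    by (simp add: aff_dim_nonempty_interior)
qed

lemma parallelogram_edge:
  assumes "E edge_of parallelogram \<alpha> i c d"
  shows "(\<forall>p\<in>E. \<forall>q\<in>E. fst p = fst q) \<or>
         (\<forall>p\<in>E. \<forall>q\<in>E. snd q - snd p = \<alpha> * (fst q - fst p))"
proof -
  define h where "h = (\<lambda>p :: real \<times> real. snd p - \<alpha> * (fst p - of_int i))"
  have face: "E face_of parallelogram \<alpha> i c d"
    using assms by (simp add: edge_of_def)
  then have E: "E \<subseteq> parallelogram \<alpha> i c d" "convex E"
    by (auto simp: face_of_def)
  have "collinear E"
    using assms by (simp add: edge_of_def collinear_aff_dim)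
  then obtain u where u: "\<And>x y. x \<in> E \<Longrightarrow> y \<in> E \<Longrightarrow> \<exists>k. x - y = k *\<^sub>R u"
    unfolding collinear_def by blast
  have aligned: "fst p = fst q \<or> h p = h q" if pq: "p \<in> E" "q \<in> E" for p q
  proof (rule ccontr)
    \<comment> \<open>Otherwise \<open>p\<close> and \<open>q\<close> are opposite corners of a parallelogram whose other diagonal \<open>rs\<close> has the same
      midpoint, so that the face \<open>E\<close> contains \<open>r\<close> too and is not collinear.\<close>
    assume "\<not> (fst p = fst q \<or> h p = h q)"
    then have neq: "fst p \<noteq> fst q" "h p \<noteq> h q"
      by auto
    define r where "r = (fst p, h q + \<alpha> * (fst p - of_int i))"
    define s where "s = (fst q, h p + \<alpha> * (fst q - of_int i))"
    have rs: "r \<in> parallelogram \<alpha> i c d" "s \<in> parallelogram \<alpha> i c d"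
      using E pq by (auto simp: r_def s_def h_def parallelogram_def subset_eq)
    have "midpoint p q = midpoint r s"
      by (simp add: midpoint_def r_def s_def h_def prod_eq_iff algebra_simps)
    moreover have "midpoint p q \<in> E"
      using E(2) pq by (metis closed_segment_subset midpoints_in_convex_hull midpoint_in_closed_segment subsetD)
    moreover have "r \<noteq> s"
      using neq by (simp add: r_def s_def)
    then have "midpoint r s \<in> open_segment r s"
      by simp
    ultimately have "r \<in> E"
      using face rs unfolding face_of_def by metis
    then obtain k l where k: "p - r = k *\<^sub>R u" and l: "p - q = l *\<^sub>R u"
      using u pq by metis
    have "snd p \<noteq> snd r"
      using neq by (auto simp: r_def h_def)
    then have "k \<noteq> 0"
      using k by (auto simp: prod_eq_iff)
    moreover have "k * fst u = 0"
      using arg_cong[OF k, of fst] by (simp add: r_def)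
    ultimately have "fst u = 0"
      by simp
    then show False
      using arg_cong[OF l, of fst] neq by simp
  qed
  have "(\<forall>p\<in>E. \<forall>q\<in>E. fst p = fst q) \<or> (\<forall>p\<in>E. \<forall>q\<in>E. h p = h q)"
    using aligned by metis
  then show ?thesis
    by (auto simp: h_def algebra_simps)
qed

lemma slanted_parallelogram: "c < d \<Longrightarrow> slanted_polygon \<alpha> (parallelogram \<alpha> i c d)"
  unfolding slanted_polygon_def
  using parallelogram_polytope parallelogram_aff_dim parallelogram_edge by blast

section \<open>The projection from the plane to the torus\<close>

lemma closed_Ints_translation: "closed {x :: real. x - c \<in> \<int>}"
proof -
  have "{x :: real. x - c \<in> \<int>} = (+) c ` \<int>"
    by (auto simp: image_iff) (metis add.commute diff_add_cancel)
  then show ?thesis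
    by (simp add: closed_translation)
qed

lemma torus_proj_congruent:
  "\<exists>m k :: int. torus_proj p = p + (2 * of_int m, of_int k)"
proof -
  have "torus_proj p = p + (2 * of_int (- \<lfloor>fst p / 2\<rfloor>), of_int (- \<lfloor>snd p\<rfloor>))"
    by (simp add: torus_proj_def frac_def prod_eq_iff)
  then show ?thesis
    by blast
qed

lemma torus_proj_add_int: "torus_proj (p + (2 * of_int m, of_int k)) = torus_proj p"
proof -
  have "(fst p + 2 * of_int m) / 2 = fst p / 2 + of_int m"
    by simp
  then have "frac ((fst p + 2 * of_int m) / 2) = frac (fst p / 2)"
    by (simp only: frac_add_of_int_right)
  then show ?thesis
    by (simp add: torus_proj_def)
qed

lemma torus_proj_in_torus: "torus_proj p \<in> torus"
  using frac_lt_1[of "fst p / 2"] frac_lt_1[of "snd p"]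
  by (simp add: torus_proj_def torus_def del: frac_lt_1)

lemma torus_proj_id: "p \<in> torus \<Longrightarrow> torus_proj p = p"
  by (auto simp: torus_proj_def torus_def prod_eq_iff frac_eq)

text \<open>The projection is an open map: the full preimage of the image of \<open>B\<close> is the
  union of the lattice translates of \<open>B\<close>.\<close>

lemma torus_open_image:
  assumes "open B"
  shows "torus_open (torus_proj ` B)"
proof -
  have "torus_proj -` torus_proj ` B = (\<Union>m::int. \<Union>k::int. (+) (2 * of_int m, of_int k) ` B)"
  proof (intro equalityI subsetI)
    fix p assume "p \<in> torus_proj -` torus_proj ` B"
    then obtain b where b: "b \<in> B" "torus_proj p = torus_proj b"
      by auto
    obtain m k m' k' where "torus_proj p = p + (2 * of_int m, of_int k)"
      "torus_proj b = b + (2 * of_int m', of_int k')"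
      using torus_proj_congruent by metis
    with b have "p = (2 * of_int (m' - m), of_int (k' - k)) + b"
      by (auto simp: prod_eq_iff)
    then show "p \<in> (\<Union>m::int. \<Union>k::int. (+) (2 * of_int m, of_int k) ` B)"
      using b by blast
  next
    fix p assume "p \<in> (\<Union>m::int. \<Union>k::int. (+) (2 * of_int m, of_int k) ` B)"
    then obtain m k b where "p = b + (2 * of_int m, of_int k)" "b \<in> B"
      by (auto simp: add.commute)
    then show "p \<in> torus_proj -` torus_proj ` B"
      using torus_proj_add_int by auto
  qed
  then show ?thesis
    using assms torus_proj_in_torus by (auto simp: torus_open_def intro!: open_UN open_translation)
qed

section \<open>Break heights, and the polygons between them\<close>

context barrier_flow
begin

text \<open>The breakpoints are the endpoints of the intervals, and 0, where \<open>frac\<close>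
  jumps. As the closed range \<open>{y..z}\<close> avoids their translates, it does not matter which
  endpoints belong to their intervals.\<close>

lemma blocked_breakpoints:
  obtains V where "finite V"
    "\<And>y z. y < z \<Longrightarrow> (\<And>v x. v \<in> V \<Longrightarrow> x \<in> {y..z} \<Longrightarrow> x - v \<notin> \<int>) \<Longrightarrow> blocked y \<longleftrightarrow> blocked z"
proof -
  obtain \<I> where \<I>: "finite \<I>" "J = \<Union>\<I>" "\<And>I. I \<in> \<I> \<Longrightarrow> is_interval I" "\<And>I. I \<in> \<I> \<Longrightarrow> I \<subseteq> {0..<1}"
    using intervals by (auto simp: finite_interval_union_def)
  define V where "V = {0} \<union> Inf ` \<I> \<union> Sup ` \<I>"
  have "blocked y \<longleftrightarrow> blocked z"
    if yz: "y < z" and V: "\<And>v x. v \<in> V \<Longrightarrow> x \<in> {y..z} \<Longrightarrow> x - v \<notin> \<int>" for y z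
  proof -
    define l where "l = \<lfloor>y\<rfloor>"
    have "\<not> l < \<lfloor>z\<rfloor>"
    proof
      assume "l < \<lfloor>z\<rfloor>"
      then have "of_int \<lfloor>z\<rfloor> \<in> {y..z}"
        by (auto simp: l_def) linarith
      then show False
        using V[of 0 "of_int \<lfloor>z\<rfloor>"] by (auto simp: V_def)
    qed
    moreover have "l \<le> \<lfloor>z\<rfloor>"
      using yz by (simp add: l_def floor_mono)
    ultimately have fr: "frac y = y - of_int l" "frac z = z - of_int l"
      by (auto simp: frac_def l_def)
    have False if v: "v \<in> V" "frac y \<le> v" "v \<le> frac z" for v
      using V[of v "v + of_int l"] v fr by auto
    then have no_break: "\<not> (frac y \<le> v \<and> v \<le> frac z)" if "v \<in> V" for v
      using that by blast
    have "frac y \<in> I \<longleftrightarrow> frac z \<in> I" if "I \<in> \<I>" for I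
    proof
      have bdd: "bdd_above I" "bdd_below I"
        using \<I>(4)[OF that] by (meson bdd_above_mono bdd_above_Ico bdd_below_mono bdd_below_Ico)+
      have btw: "w \<in> I" if "x \<in> I" "x' \<in> I" "x \<le> w" "w \<le> x'" for x x' w
        using \<I>(3)[OF \<open>I \<in> \<I>\<close>] that by (meson mem_is_interval_1_I)
      have less: "frac y < frac z"
        using fr yz by simp
      show "frac z \<in> I" if y: "frac y \<in> I"
      proof (rule ccontr)
        assume z: "frac z \<notin> I"
        have "Sup I \<le> frac z"
          using y z btw[OF y, of _ "frac z"] less by (intro cSup_least) (auto intro!: leI dest: less_imp_le)
        moreover have "frac y \<le> Sup I"
          using y bdd by (intro cSup_upper)
        ultimately show False
          using no_break[of "Sup I"] \<open>I \<in> \<I>\<close> by (auto simp: V_def)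
      qed
      show "frac y \<in> I" if z: "frac z \<in> I"
      proof (rule ccontr)
        assume y: "frac y \<notin> I"
        have "frac y \<le> Inf I"
          using y z btw[OF _ z, of _ "frac y"] less by (intro cInf_greatest) (auto intro!: leI dest: less_imp_le)
        moreover have "Inf I \<le> frac z"
          using z bdd by (intro cInf_lower)
        ultimately show False
          using no_break[of "Inf I"] \<open>I \<in> \<I>\<close> by (auto simp: V_def)
      qed
    qed
    then have "frac y \<in> \<Union>\<I> \<longleftrightarrow> frac z \<in> \<Union>\<I>"
      by auto
    then show ?thesis
      unfolding blocked_def using \<I>(2) by simp
  qed
  moreover have "finite V"
    using \<I>(1) by (simp add: V_def)
  ultimately show ?thesis
    using that by blast
qed

text \<open>Containing 0 and 1 ensures that every other height in the unit interval lies between two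
  neighbouring breaks, which bound a parallelogram.\<close>

definition is_breakset :: "real set \<Rightarrow> bool" where
  "is_breakset C \<longleftrightarrow> finite C \<and> C \<subseteq> {0..1} \<and> 0 \<in> C \<and> 1 \<in> C \<and>
     (\<forall>y z. y < z \<longrightarrow> (\<forall>c\<in>C. \<forall>x\<in>{y..z}. x - c \<notin> \<int>) \<longrightarrow> sync y = sync z)"

text \<open>By \<open>sync_cong\<close> a change of \<open>sync\<close> at a height comes from a
  change of \<open>blocked\<close> at most \<open>sync_steps\<close> rotations earlier; so the
  breakpoints of \<open>blocked\<close>, rotated forwards that often, suffice.\<close>

lemma ex_breakset: "\<exists>C. is_breakset C"
proof -
  obtain V where V: "finite V"
    "\<And>y z. y < z \<Longrightarrow> (\<And>v x. v \<in> V \<Longrightarrow> x \<in> {y..z} \<Longrightarrow> x - v \<notin> \<int>) \<Longrightarrow> blocked y \<longleftrightarrow> blocked z"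
    using blocked_breakpoints by blast
  define C where "C = {0, 1} \<union> (\<lambda>(v, n). frac (v + real n * \<alpha>)) ` (V \<times> {..sync_steps})"
  have "sync y = sync z" if yz: "y < z" and C: "\<forall>c\<in>C. \<forall>x\<in>{y..z}. x - c \<notin> \<int>" for y z
  proof (rule sync_cong, rule V(2))
    fix n v x assume n: "n \<le> sync_steps" and v: "v \<in> V" and x: "x \<in> {y - real n * \<alpha>..z - real n * \<alpha>}"
    have "frac (v + real n * \<alpha>) \<in> C"
      using n v by (force simp: C_def)
    then have "x + real n * \<alpha> - frac (v + real n * \<alpha>) \<notin> \<int>"
      using C x by auto
    moreover have "x + real n * \<alpha> - frac (v + real n * \<alpha>) = x - v + of_int \<lfloor>v + real n * \<alpha>\<rfloor>"
      by (simp add: frac_def)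
    ultimately show "x - v \<notin> \<int>"
      by (metis Ints_add Ints_of_int)
  qed (use yz in simp)
  moreover have "C \<subseteq> {0..1}"
    by (auto simp: C_def intro: frac_lt_1[THEN less_imp_le])
  ultimately have "is_breakset C"
    using V(1) by (auto simp: is_breakset_def C_def)
  then show ?thesis ..
qed

definition breaks :: "real set" where
  "breaks = (SOME C. is_breakset C)"

lemma breakset_breaks: "is_breakset breaks"
  unfolding breaks_def using ex_breakset by (rule someI_ex)

lemma breaks: "finite breaks" "breaks \<subseteq> {0..1}" "0 \<in> breaks" "1 \<in> breaks"
  using breakset_breaks by (auto simp: is_breakset_def)

lemma sync_eq_between:
  assumes "\<And>c x. c \<in> breaks \<Longrightarrow> x \<in> closed_segment y z \<Longrightarrow> x - c \<notin> \<int>"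
  shows "sync y = sync z"
proof -
  have "sync u = sync v" if "u < v" "{u..v} = closed_segment y z" for u v
    using breakset_breaks assms that by (auto simp: is_breakset_def)
  then show ?thesis
    by (cases y z rule: linorder_cases) (auto simp: closed_segment_eq_real_ivl)
qed

text \<open>The vertical edges and the flow segments starting at break heights. They contain the
  sides of all polygons used below and are the null set outside which the descriptions are
  exact.\<close>

definition grid :: "(real \<times> real) set" where
  "grid = {p. fst p \<in> \<int> \<or> (\<exists>c\<in>breaks. base p - c \<in> \<int>)}"

text \<open>On each strip between consecutive vertical edges \<open>base\<close> is affine, so
  countably many lines cover the set.\<close>

lemma negligible_grid: "negligible grid"
proof -
  define V where "V = (\<lambda>j::int. {p :: real \<times> real. (1, 0) \<bullet> p = of_int j})"
  define S where "S = (\<lambda>(c, j::int, k::int). {p :: real \<times> real. (- \<alpha>, 1) \<bullet> p = c + of_int k - \<alpha> * of_int j})"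
  have "grid \<subseteq> (\<Union>j. V j) \<union> (\<Union>z\<in>breaks \<times> UNIV. S z)"
  proof
    fix p assume "p \<in> grid"
    then consider "fst p \<in> \<int>" | c where "c \<in> breaks" "base p - c \<in> \<int>"
      by (auto simp: grid_def)
    then show "p \<in> (\<Union>j. V j) \<union> (\<Union>z\<in>breaks \<times> UNIV. S z)"
    proof cases
      case 1
      then show ?thesis
        by (auto simp: V_def inner_prod_def elim: Ints_cases)
    next
      case 2
      then obtain k where "base p - c = of_int k"
        by (auto elim: Ints_cases)
      then have "p \<in> S (c, \<lfloor>fst p\<rfloor>, k)"
        by (simp add: S_def inner_prod_def base_def frac_def algebra_simps)
      then show ?thesis
        using 2 by blast
    qed
  qed
  moreover have "negligible (\<Union>j. V j)"
    by (intro negligible_countable_Union) (auto simp: V_def zero_prod_def intro!: negligible_hyperplane)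
  moreover have "negligible (\<Union>z\<in>breaks \<times> UNIV. S z)"
    using breaks(1)
    by (intro negligible_countable_Union countable_image countable_SIGMA)
       (auto simp: S_def zero_prod_def intro!: negligible_hyperplane countable_finite)
  ultimately show ?thesis
    by (meson negligible_Un negligible_subset)
qed

lemma base_add_int: "base (p + (of_int m, of_int k)) - base p \<in> \<int>"
  by (simp add: base_def)

lemma synced_add_int: "synced (p + (2 * of_int m, of_int k)) \<longleftrightarrow> synced p"
proof -
  have "\<lfloor>fst p + of_int (2 * m)\<rfloor> mod 2 = \<lfloor>fst p\<rfloor> mod 2"
    by (simp only: floor_add_int[symmetric] mod_mult_self2)
  then show ?thesis
    using sync_diff_int[OF base_add_int[of p "2 * m" k]] by (simp add: synced_def)
qed

lemma synced_torus_proj: "synced (torus_proj p) \<longleftrightarrow> synced p"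
  using torus_proj_congruent[of p] synced_add_int by metis

lemma grid_add_int: "p + (of_int m, of_int k) \<in> grid \<longleftrightarrow> p \<in> grid"
proof -
  have "base (p + (of_int m, of_int k)) - c \<in> \<int> \<longleftrightarrow> base p - c \<in> \<int>" for c
    using base_add_int[of p m k] unfolding frac_eq_iff_diff_Ints[symmetric] by simp
  moreover have "fst p + of_int m \<in> \<int> \<longleftrightarrow> fst p \<in> \<int>"
    by simp
  ultimately show ?thesis
    by (simp add: grid_def)
qed

lemma grid_torus_proj: "torus_proj p \<in> grid \<longleftrightarrow> p \<in> grid"
  using torus_proj_congruent[of p] grid_add_int[of p "2 * _"] by (metis of_int_mult of_int_numeral)

text \<open>\<open>base\<close> does not see the square while the parity flips: of the two points
  above a point of the unit torus exactly one is synchronised.\<close>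

lemma synced_shift: "synced (p + (1, 0)) \<longleftrightarrow> \<not> synced p"
proof -
  have "base (p + (1, 0)) = base p"
    using frac_add_of_int_right[of "fst p" 1] by (simp add: base_def)
  moreover have "\<lfloor>fst p + 1\<rfloor> mod 2 = 1 - \<lfloor>fst p\<rfloor> mod 2"
    by simp presburger
  ultimately show ?thesis
    using sync_cases[of "base p"] unfolding synced_def fst_add fst_conv by presburger
qed

lemma synced_locally_constant:
  assumes "p \<notin> grid"
  obtains e where "e > 0" "\<And>q. dist p q < e \<Longrightarrow> synced q \<longleftrightarrow> synced p"
proof -
  define S where "S = - (\<Union>c\<in>breaks. {x. x - c \<in> \<int>})"
  have "open S"
    unfolding S_def using breaks(1) closed_Ints_translation by (intro open_Compl closed_UN) auto
  moreover have "base p \<in> S"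
    using assms by (auto simp: grid_def S_def)
  ultimately obtain \<delta> where \<delta>: "\<delta> > 0" "ball (base p) \<delta> \<subseteq> S"
    by (meson openE)
  define f where "f = frac (fst p)"
  have f: "0 < f" "f < 1"
    using assms by (auto simp: f_def grid_def frac_gt_0_iff frac_lt_1)
  \<comment> \<open>The first bound keeps \<open>q\<close> inside the open strip of
    \<open>p\<close>. There \<open>base\<close> varies by less than
    \<open>(1 + \<alpha>) * e\<close>, and the second bound makes this at most \<delta>.\<close>
  define e where "e = min (min f (1 - f)) (\<delta> / (1 + \<alpha>))"
  have "e > 0"
    using f \<delta> alpha_pos by (simp add: e_def)
  moreover have "synced q \<longleftrightarrow> synced p" if "dist p q < e" for q
  proof -
    have x: "\<bar>fst q - fst p\<bar> < e" and y: "\<bar>snd q - snd p\<bar> < e"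
      using that dist_fst_le[of p q] dist_snd_le[of p q] by (auto simp: dist_real_def abs_minus_commute)
    then have fl: "\<lfloor>fst q\<rfloor> = \<lfloor>fst p\<rfloor>"
      unfolding e_def f_def frac_def by linarith
    then have "base q - base p = (snd q - snd p) - \<alpha> * (fst q - fst p)"
      by (simp add: base_def frac_def algebra_simps)
    also have "\<bar>\<dots>\<bar> \<le> \<bar>snd q - snd p\<bar> + \<alpha> * \<bar>fst q - fst p\<bar>"
      using abs_triangle_ineq4[of "snd q - snd p" "\<alpha> * (fst q - fst p)"] alpha_pos by (simp add: abs_mult)
    also have "\<dots> < e + \<alpha> * e"
      using x y alpha_pos by (intro add_strict_mono) auto
    also have "\<dots> = e * (1 + \<alpha>)"
      by (simp add: algebra_simps)
    also have "\<dots> \<le> \<delta> / (1 + \<alpha>) * (1 + \<alpha>)"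
      using alpha_pos by (intro mult_right_mono) (auto simp: e_def)
    also have "\<dots> = \<delta>"
      using alpha_pos by simp
    finally have "closed_segment (base p) (base q) \<subseteq> ball (base p) \<delta>"
      using \<delta>(1) by (intro closed_segment_subset) (auto simp: dist_real_def abs_minus_commute)
    then have "sync (base p) = sync (base q)"
      using \<delta>(2) by (intro sync_eq_between) (auto simp: S_def)
    then show ?thesis
      using fl by (simp add: synced_def)
  qed
  ultimately show ?thesis
    using that by blast
qed

lemma frontier_synced: "frontier (Collect synced) \<subseteq> grid"
proof
  fix p assume p: "p \<in> frontier (Collect synced)"
  show "p \<in> grid"
  proof (rule ccontr)
    assume "p \<notin> grid"
    then obtain e where "e > 0" "\<And>q. dist p q < e \<Longrightarrow> synced q \<longleftrightarrow> synced p"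
      using synced_locally_constant by blast
    then show False
      using p unfolding frontier_straddle by blast
  qed
qed

lemma bounded_torus: "bounded torus" and convex_torus: "convex torus"
  by (auto simp: torus_def intro: bounded_Times convex_Times)

lemma negligible_frontier_attractor: "negligible (frontier attractor)"
proof -
  have "attractor = torus \<inter> Collect synced"
    by (auto simp: attractor_def)
  then have "frontier attractor \<subseteq> frontier torus \<union> grid"
    using frontier_Int_subset[of torus "Collect synced"] frontier_synced by auto
  then show ?thesis
    using negligible_grid negligible_convex_frontier[OF convex_torus]
    by (meson negligible_Un negligible_subset)
qed

lemma attractor_lmeasurable: "attractor \<in> lmeasurable"
  using negligible_frontier_attractor bounded_subset[OF bounded_torus, of attractor]
  by (intro measurable_Jordan) (auto simp: attractor_def)

text \<open>\<open>b\<close> selects the recurrent or the transient set, so that one argument serves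
  both. Between neighbouring breaks \<open>sync\<close> is constant; hence a parallelogram over such
  a gap is, off the grid, either entirely synchronised or not at all.\<close>

lemma finite_slanted_polygon_union_synced:
  assumes S: "S \<subseteq> torus" "\<And>p. p \<in> torus \<Longrightarrow> p \<notin> grid \<Longrightarrow> p \<in> S \<longleftrightarrow> (synced p \<longleftrightarrow> b)"
  shows "finite_slanted_polygon_union \<alpha> S"
proof -
  define \<Q> where "\<Q> = {parallelogram \<alpha> i c d | i c d. i \<in> {0, 1} \<and> c \<in> breaks \<and> d \<in> breaks \<and> c < d
      \<and> (\<forall>y\<in>{c<..<d}. i = sync y \<longleftrightarrow> b)}"
  have "\<Q> \<subseteq> (\<lambda>(i, c, d). parallelogram \<alpha> i c d) ` ({0, 1} \<times> breaks \<times> breaks)"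
    by (force simp: \<Q>_def)
  then have fin: "finite \<Q>"
    by (rule finite_subset) (simp add: breaks)
  have "p \<in> torus_proj ` \<Union>\<Q>" if p: "p \<in> S" "p \<notin> grid" for p
  proof -
    have pt: "p \<in> torus" "synced p \<longleftrightarrow> b"
      using p S(1) S(2)[of p] by blast+
    define y where "y = frac (base p)"
    have y_breaks: "y - c \<notin> \<int>" if "c \<in> breaks" for c
    proof
      assume "y - c \<in> \<int>"
      then have "y - c + of_int \<lfloor>base p\<rfloor> \<in> \<int>"
        by simp
      then have "base p - c \<in> \<int>"
        by (simp add: y_def frac_def)
      then show False
        using that p(2) by (auto simp: grid_def)
    qed
    have "base p \<notin> \<int>"
      using p(2) breaks(3) by (force simp: grid_def)
    then have y: "0 < y" "y < 1"
      by (auto simp: y_def frac_gt_0_iff frac_lt_1)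
    \<comment> \<open>Both neighbours of \<open>y\<close> exist because 0 and 1 are breaks.\<close>
    define c where "c = Max {c \<in> breaks. c < y}"
    define d where "d = Min {d \<in> breaks. y < d}"
    have c: "c \<in> breaks" "c < y"
    proof -
      have "c \<in> {c \<in> breaks. c < y}"
        unfolding c_def using breaks y by (intro Max_in) auto
      then show "c \<in> breaks" "c < y"
        by auto
    qed
    have d: "d \<in> breaks" "y < d"
    proof -
      have "d \<in> {d \<in> breaks. y < d}"
        unfolding d_def using breaks y by (intro Min_in) auto
      then show "d \<in> breaks" "y < d"
        by auto
    qed
    \<comment> \<open>Inside (0, 1), congruence modulo 1 to a break means equality with it, and no
      break lies strictly between the neighbours of \<open>y\<close>.\<close>
    have gap: "x - v \<notin> \<int>" if "x \<in> {c<..<d}" "v \<in> breaks" for x v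
    proof
      assume "x - v \<in> \<int>"
      moreover have "0 < x" "x < 1" "0 \<le> v" "v \<le> 1"
        using that c d breaks(2) by (auto simp: subset_eq)
      then have "\<bar>x - v\<bar> < 1"
        by linarith
      ultimately have "x = v"
        using Ints_nonzero_abs_less1 by force
      moreover have "v \<noteq> y"
        using y_breaks[OF that(2)] by auto
      then have "v \<le> c \<or> d \<le> v"
        using that(2) breaks(1) by (cases "v < y") (auto simp: c_def d_def)
      ultimately show False
        using that(1) by auto
    qed
    define i where "i = \<lfloor>fst p\<rfloor>"
    have i: "i \<in> {0, 1}"
      using torus_floor pt by (simp add: i_def)
    have "i = sync x \<longleftrightarrow> b" if x: "x \<in> {c<..<d}" for x
    proof -
      have "closed_segment x y \<subseteq> {c<..<d}"
        using x c d by (intro closed_segment_subset) auto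
      then have "sync x = sync y"
        using gap by (intro sync_eq_between) auto
      also have "\<dots> = sync (base p)"
        by (intro sync_diff_int) (simp add: y_def frac_def)
      finally show ?thesis
        using pt(2) i by (auto simp: synced_def i_def)
    qed
    then have "parallelogram \<alpha> i c d \<in> \<Q>"
      using i c d unfolding \<Q>_def mem_Collect_eq
      by (intro exI[of _ i] exI[of _ c] exI[of _ d]) auto
    \<comment> \<open>The representative of \<open>p\<close> with \<open>base\<close> in [0, 1) may
      leave the fundamental domain upwards; the projection brings it back.\<close>
    moreover have "(fst p, y + \<alpha> * frac (fst p)) \<in> parallelogram \<alpha> i c d"
      using c d frac_lt_1[of "fst p"] frac_ge_0[of "fst p"] by (auto simp: parallelogram_def i_def frac_def)
    moreover have "torus_proj (fst p, y + \<alpha> * frac (fst p)) = p"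
    proof -
      have "(fst p, y + \<alpha> * frac (fst p)) = p + (2 * of_int 0, of_int (- \<lfloor>base p\<rfloor>))"
        by (simp add: y_def frac_def base_def prod_eq_iff)
      then show ?thesis
        using torus_proj_add_int[of p 0 "- \<lfloor>base p\<rfloor>"] torus_proj_id[OF pt(1)] by metis
    qed
    ultimately show ?thesis
      by (metis Union_iff image_eqI)
  qed
  moreover have "torus_proj q \<in> S" if q: "q \<in> Q" "Q \<in> \<Q>" "torus_proj q \<notin> grid" for q Q
  proof -
    obtain i c d where Q: "Q = parallelogram \<alpha> i c d" "i \<in> {0, 1}" "c \<in> breaks" "d \<in> breaks"
      "\<And>y. y \<in> {c<..<d} \<Longrightarrow> i = sync y \<longleftrightarrow> b"
      using q(2) unfolding \<Q>_def by blast
    have "q \<notin> grid"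
      using q(3) by (simp add: grid_torus_proj)
    then have fst_q: "fst q \<notin> \<int>" and base_q: "base q \<noteq> c" "base q \<noteq> d"
      using Q by (auto simp: grid_def)
    \<comment> \<open>The closed parallelogram includes its right edge, where the floor is already
      \<open>i + 1\<close>; this edge lies in \<open>grid\<close>.\<close>
    have "fst q \<noteq> of_int i + 1"
      using fst_q by (metis Ints_1 Ints_add Ints_of_int)
    then have fl: "\<lfloor>fst q\<rfloor> = i"
      using q(1) Q(1) by (auto simp: parallelogram_def floor_eq_iff)
    then have "base q = snd q - \<alpha> * (fst q - of_int i)"
      by (simp add: base_def frac_def)
    then have "base q \<in> {c<..<d}"
      using q(1) base_q by (auto simp: Q(1) parallelogram_def)
    then have "synced q \<longleftrightarrow> b"
      using Q fl by (auto simp: synced_def)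
    then show ?thesis
      using S(2)[OF torus_proj_in_torus q(3)] by (simp add: synced_torus_proj)
  qed
  ultimately have "sym_diff S (torus_proj ` \<Union>\<Q>) \<subseteq> grid"
    by blast
  then have "negligible (sym_diff S (torus_proj ` \<Union>\<Q>))"
    using negligible_grid negligible_subset by blast
  moreover have "\<forall>Q\<in>\<Q>. slanted_polygon \<alpha> Q"
    using slanted_parallelogram by (auto simp: \<Q>_def)
  ultimately show ?thesis
    unfolding finite_slanted_polygon_union_def using fin by blast
qed

end

subsection \<open>Area, recurrence and uniform distribution\<close>

lemma borel_imp_lebesgue: "A \<in> sets borel \<Longrightarrow> A \<in> sets lebesgue"
  by (rule sets_completionI_sets) simp

lemma negligible_axis_line:
  "negligible {p :: real \<times> real. fst p = a}" "negligible {p :: real \<times> real. snd p = a}"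
proof -
  have "negligible {p :: real \<times> real. (1, 0) \<bullet> p = a}" "negligible {p :: real \<times> real. (0, 1) \<bullet> p = a}"
    by (rule negligible_hyperplane, simp add: zero_prod_def)+
  then show "negligible {p :: real \<times> real. fst p = a}" "negligible {p :: real \<times> real. snd p = a}"
    by (simp_all add: inner_prod_def)
qed

definition unit_square :: "(real \<times> real) set" where
  "unit_square = {0..<1} \<times> {0..<1}"

text \<open>The inverse image in the plane of the image of \<open>S\<close> in the unit torus.\<close>

definition fold_set :: "(real \<times> real) set \<Rightarrow> (real \<times> real) set" where
  "fold_set S = {q. (frac (fst q), frac (snd q)) \<in> S \<or> (1 + frac (fst q), frac (snd q)) \<in> S}"

lemma measure_cbox_unit_square:
  assumes "negligible (frontier F)"
  shows "measure lebesgue (F \<inter> cbox (0, 0) (1, 1)) = measure lebesgue (F \<inter> unit_square)"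
proof -
  define Q where "Q = cbox (0, 0) (1 :: real, 1 :: real)"
  have neg: "negligible (frontier (F \<inter> B))" if "convex B" for B
    using assms negligible_convex_frontier[OF that] frontier_Int_subset[of F B]
    by (meson negligible_Un negligible_subset)
  have convex: "convex unit_square" "bounded unit_square"
    by (auto simp: unit_square_def intro: convex_Times bounded_Times)
  have "F \<inter> unit_square \<in> lmeasurable"
    using neg convex by (intro measurable_Jordan bounded_Int) auto
  moreover have "sym_diff (F \<inter> unit_square) (F \<inter> Q)
      \<subseteq> {p. fst p = 1} \<union> {p. snd p = 1}"
    by (auto simp: unit_square_def Q_def)
  then have "negligible (sym_diff (F \<inter> unit_square) (F \<inter> Q))"
    using negligible_axis_line by (meson negligible_Un negligible_subset)
  ultimately show ?thesis
    using measure_negligible_symdiff by (simp add: Q_def)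
qed

text \<open>Near a point with no integer coordinate, \<open>fold_set S\<close> coincides with the
  union of two integer translates of \<open>S\<close>. So its frontier lies in countably many lines
  and translated frontiers of \<open>S\<close>.\<close>

lemma negligible_frontier_fold_set:
  assumes "negligible (frontier S)"
  shows "negligible (frontier (fold_set S))"
proof -
  define A where "A = (\<lambda>m k :: int. (+) (of_int m, of_int k) ` S)"
  define V where "V = (\<lambda>j::int. {p :: real \<times> real. fst p = of_int j})"
  define H where "H = (\<lambda>j::int. {p :: real \<times> real. snd p = of_int j})"
  have mem_A: "q \<in> A m k \<longleftrightarrow> (fst q - of_int m, snd q - of_int k) \<in> S" for q m k
  proof -
    have "q \<in> A m k \<longleftrightarrow> q - (of_int m, of_int k) \<in> S"
      unfolding A_def by (auto simp: image_iff) (metis add.commute diff_add_cancel)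
    then show ?thesis
      by (cases q) simp
  qed
  have "q \<in> (\<Union>j. V j) \<union> (\<Union>j. H j) \<union> (\<Union>m. \<Union>k. frontier (A m k))"
    if q: "q \<in> frontier (fold_set S)" for q
  proof (cases "fst q \<in> \<int> \<or> snd q \<in> \<int>")
    case True
    then show ?thesis
      by (auto simp: V_def H_def elim!: Ints_cases)
  next
    case False
    define m where "m = \<lfloor>fst q\<rfloor>"
    define k where "k = \<lfloor>snd q\<rfloor>"
    define f where "f = frac (fst q)"
    define g where "g = frac (snd q)"
    define e where "e = min (min f (1 - f)) (min g (1 - g))"
    have e: "e > 0"
      using False by (auto simp: e_def f_def g_def frac_gt_0_iff frac_lt_1)
    have near: "p \<in> fold_set S \<longleftrightarrow> p \<in> A m k \<union> A (m - 1) k" if "dist q p < e" for p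
    proof -
      have "\<bar>fst p - fst q\<bar> < e" and "\<bar>snd p - snd q\<bar> < e"
        using that dist_fst_le[of q p] dist_snd_le[of q p] by (auto simp: dist_real_def abs_minus_commute)
      moreover have "e \<le> f" "e \<le> 1 - f" "e \<le> g" "e \<le> 1 - g"
        by (simp_all add: e_def)
      moreover have "f = fst q - of_int m" "g = snd q - of_int k"
        by (simp_all add: f_def g_def m_def k_def frac_def)
      ultimately have "of_int m \<le> fst p \<and> fst p < of_int m + 1 \<and> of_int k \<le> snd p \<and> snd p < of_int k + 1"
        by linarith
      then have "\<lfloor>fst p\<rfloor> = m" "\<lfloor>snd p\<rfloor> = k"
        by (simp_all add: floor_eq_iff)
      then show ?thesis
        by (simp add: fold_set_def mem_A frac_def algebra_simps)
    qed
    have "q \<in> frontier (A m k \<union> A (m - 1) k)"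
      unfolding frontier_straddle
    proof (intro allI impI)
      fix \<epsilon> :: real assume "\<epsilon> > 0"
      then have "min \<epsilon> e > 0"
        using e by simp
      then obtain x y where "x \<in> fold_set S" "dist q x < min \<epsilon> e" "y \<notin> fold_set S" "dist q y < min \<epsilon> e"
        using q unfolding frontier_straddle by meson
      then show "(\<exists>x\<in>A m k \<union> A (m - 1) k. dist q x < \<epsilon>) \<and> (\<exists>x. x \<notin> A m k \<union> A (m - 1) k \<and> dist q x < \<epsilon>)"
        using near by (metis min_less_iff_conj)
    qed
    then have "q \<in> frontier (A m k) \<or> q \<in> frontier (A (m - 1) k)"
      using frontier_Un_subset by (metis Un_iff subsetD)
    then show ?thesis
      by (elim disjE) (rule UnI2, rule UN_I[OF UNIV_I], rule UN_I[OF UNIV_I], assumption)+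
  qed
  then have "frontier (fold_set S) \<subseteq> (\<Union>j. V j) \<union> (\<Union>j. H j) \<union> (\<Union>m. \<Union>k. frontier (A m k))"
    by blast
  moreover have "negligible (\<Union>j. V j)" "negligible (\<Union>j. H j)"
    by (intro negligible_countable_Union;
        auto simp: V_def H_def negligible_axis_line)+
  moreover have "negligible (frontier (A m k))" for m k
    using negligible_translation[OF assms] by (simp add: A_def frontier_translation)
  then have "negligible (\<Union>k. frontier (A m k))" for m
    by (intro negligible_countable_Union) auto
  then have "negligible (\<Union>m. \<Union>k. frontier (A m k))"
    by (intro negligible_countable_Union) auto
  ultimately show ?thesis
    by (meson negligible_Un negligible_subset)
qed

section \<open>The attractor and the flow seen in the unit torus\<close>

context barrier_flow
begin

text \<open>Folding moves the part of \<open>S\<close> in the right square onto the left square. The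
  moved part is disjoint from the rest by \<open>attractor_unique\<close>, so no area is
  lost.\<close>

lemma measure_fold_set:
  assumes sub: "S \<subseteq> attractor" and S: "S \<in> lmeasurable"
  shows "measure lebesgue (fold_set S \<inter> unit_square) = measure lebesgue S"
proof -
  define S0 where "S0 = S \<inter> {p. fst p < 1}"
  define S1 where "S1 = S \<inter> {p. 1 \<le> fst p}"
  have "{p :: real \<times> real. fst p < 1} \<in> sets lebesgue"
    by (intro borel_imp_lebesgue borel_open open_Collect_less continuous_intros)
  then have S0: "S0 \<in> lmeasurable"
    using S by (simp add: S0_def fmeasurable_Int_fmeasurable)
  have "{p :: real \<times> real. 1 \<le> fst p} \<in> sets lebesgue"
    by (intro borel_imp_lebesgue borel_closed closed_Collect_le continuous_intros)
  then have S1: "S1 \<in> lmeasurable"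
    using S by (simp add: S1_def fmeasurable_Int_fmeasurable)
  have torus: "p \<in> S \<Longrightarrow> p \<in> torus" for p
    using sub by (auto simp: attractor_def)
  have "S = S0 \<union> S1" "S0 \<inter> S1 = {}"
    by (auto simp: S0_def S1_def)
  then have "measure lebesgue S = measure lebesgue S0 + measure lebesgue S1"
    using measure_Un3[OF S0 S1] by simp
  moreover have "fold_set S \<inter> unit_square = S0 \<union> (+) (- 1, 0) ` S1"
  proof (intro equalityI subsetI)
    fix q assume "q \<in> fold_set S \<inter> unit_square"
    then have q: "(fst q, snd q) \<in> S \<or> (1 + fst q, snd q) \<in> S" "0 \<le> fst q" "fst q < 1"
      by (auto simp: fold_set_def unit_square_def frac_eq[THEN iffD2])
    from q(1) show "q \<in> S0 \<union> (+) (- 1, 0) ` S1"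
    proof
      assume "(1 + fst q, snd q) \<in> S"
      then have "(1 + fst q, snd q) \<in> S1"
        using q(2) by (simp add: S1_def)
      moreover have "q = (- 1, 0) + (1 + fst q, snd q)"
        by (simp add: prod_eq_iff)
      ultimately show ?thesis
        by blast
    qed (use q(3) in \<open>simp add: S0_def\<close>)
  next
    fix q assume "q \<in> S0 \<union> (+) (- 1, 0) ` S1"
    then have "q \<in> S \<and> fst q < 1 \<or> (1 + fst q, snd q) \<in> S \<and> 0 \<le> fst q"
      by (auto simp: S0_def S1_def)
    then show "q \<in> fold_set S \<inter> unit_square"
      using torus[of q] torus[of "(1 + fst q, snd q)"]
      by (auto simp: fold_set_def unit_square_def torus_def mem_Times_iff frac_eq[THEN iffD2])
  qed
  moreover have "S0 \<inter> (+) (- 1, 0) ` S1 = {}"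
  proof -
    have False if "p \<in> S0" "q \<in> S1" "p = (- 1, 0) + q" for p q
    proof -
      have "p = q"
        using that sub by (intro attractor_unique) (auto simp: S0_def S1_def)
      then show False
        using that(3) by (simp add: prod_eq_iff)
    qed
    then show ?thesis
      by blast
  qed
  moreover have "measure lebesgue ((+) (- 1, 0) ` S1) = measure lebesgue S1"
    by (rule measure_translation)
  moreover have "(+) (- 1, 0) ` S1 \<in> lmeasurable"
    using S1 by (rule measurable_translation)
  ultimately show ?thesis
    using measure_Un3[OF S0, of "(+) (- 1, 0) ` S1"] by simp
qed

text \<open>By \<open>synced_shift\<close> every point of the unit torus has a synchronised point
  above it, so folding the attractor yields the whole plane.\<close>

lemma measure_attractor: "measure lebesgue attractor = 1"
proof -
  have "q \<in> fold_set attractor" for q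
  proof -
    have "synced (frac (fst q), frac (snd q)) \<or> synced (1 + frac (fst q), frac (snd q))"
      using synced_shift[of "(frac (fst q), frac (snd q))"] by (auto simp: add.commute)
    then show ?thesis
      using frac_lt_1[of "fst q"] frac_lt_1[of "snd q"]
      by (auto simp: fold_set_def attractor_def torus_def simp del: frac_lt_1)
  qed
  then have "fold_set attractor = UNIV"
    by auto
  then have "measure lebesgue attractor = measure lebesgue (UNIV \<inter> unit_square)"
    using measure_fold_set[OF order_refl attractor_lmeasurable] by simp
  also have "\<dots> = measure lebesgue (UNIV \<inter> cbox (0, 0) (1 :: real, 1 :: real))"
    by (rule measure_cbox_unit_square[symmetric]) simp
  also have "\<dots> = 1"
    by (simp add: content_Pair)
  finally show ?thesis .
qed

text \<open>Makes the set of times spent in a Borel set measurable. \<open>flow_eq\<close> speaks of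
  nonnegative times, so its right-hand side is taken as a Borel extension to all times.\<close>

lemma flow_borel_measurable:
  assumes "p \<in> torus"
  shows "\<exists>\<Phi>. \<Phi> \<in> borel_measurable borel \<and> (\<forall>t\<ge>0. flow t p = \<Phi> t)"
proof -
  define \<Phi> where "\<Phi> = (\<lambda>t. (of_int (state (base p) \<lfloor>fst p\<rfloor> (crossings t p)) + frac (fst p + t / speed),
                     frac (snd p + \<alpha> * (t / speed))))"
  have [measurable]: "(\<lambda>t. crossings t p) \<in> borel \<rightarrow>\<^sub>M count_space UNIV"
    unfolding crossings_def by measurable
  have "\<Phi> \<in> borel_measurable borel"
    unfolding \<Phi>_def frac_def by measurable
  then show ?thesis
    using flow_eq[OF assms] by (auto simp: \<Phi>_def)
qed

text \<open>After \<open>sync_time\<close> the flow line is in the attractor and congruent modulo 1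
  to the linear flow; \<open>attractor_unique\<close> turns congruence to a point of
  \<open>S\<close> into equality.\<close>

lemma flow_in_iff_fold_set:
  assumes "S \<subseteq> attractor" and "p \<in> torus" and "t \<ge> sync_time"
  shows "flow t p \<in> S \<longleftrightarrow> p + t *\<^sub>R (1 / speed, \<alpha> * (1 / speed)) \<in> fold_set S"
proof -
  define z where "z = flow t p"
  define w where "w = p + t *\<^sub>R (1 / speed, \<alpha> * (1 / speed))"
  have t: "t \<ge> 0"
    using assms(3) sync_time_nonneg by simp
  have z: "z \<in> attractor" "z \<in> torus"
    using flow_eventually_attractor[OF assms(2,3)] by (auto simp: z_def attractor_def)
  have fr: "frac (fst z) = frac (fst w)" "frac (snd z) = frac (snd w)"
    using flow_congruent[OF assms(2) t] unfolding frac_eq_iff_diff_Ints by (simp_all add: z_def w_def mult.commute)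
  have "frac (snd z) = snd z"
    using z(2) by (auto simp: torus_def frac_eq)
  moreover have "fst z = of_int \<lfloor>fst z\<rfloor> + frac (fst w)"
    using fr(1) by (simp add: frac_def)
  ultimately have "z = (of_int \<lfloor>fst z\<rfloor> + frac (fst w), frac (snd w))"
    using fr(2) by (simp add: prod_eq_iff)
  moreover have "\<lfloor>fst z\<rfloor> = 0 \<or> \<lfloor>fst z\<rfloor> = 1"
    using torus_floor[OF z(2)] by simp
  ultimately have "z \<in> S \<Longrightarrow> w \<in> fold_set S"
    by (auto simp: fold_set_def)
  moreover have "z \<in> S" if w: "w \<in> fold_set S"
  proof -
    obtain j :: int where e: "(of_int j + frac (fst w), frac (snd w)) \<in> S" (is "?e \<in> S")
      using w by (auto simp: fold_set_def intro: that[of 0] that[of 1])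
    have "frac (fst ?e) = frac (fst z)" "frac (snd ?e) = frac (snd z)"
      using fr by simp_all
    then have "?e = z"
      using e assms(1) z(1) by (intro attractor_unique) (auto simp flip: frac_eq_iff_diff_Ints)
    then show ?thesis
      using e by simp
  qed
  ultimately show ?thesis
    unfolding z_def w_def by blast
qed

text \<open>For some late time \<open>t\<close>, a point \<open>q\<close> of the neighbourhood is
  carried exactly to \<open>p\<close>. Whether \<open>q\<close> itself is synchronised does not
  matter: after more than \<open>sync_time\<close> its image lies in the attractor and is congruent
  to \<open>p\<close>, hence equals \<open>p\<close>.\<close>

lemma attractor_recurrent: "attractor \<subseteq> recurrent_set \<alpha> J"
proof
  fix p assume p: "p \<in> attractor"
  then have pt: "p \<in> torus"
    by (simp add: attractor_def)
  have "\<exists>t>t0. D \<inter> flow t ` D \<noteq> {}" if D: "torus_open D" "p \<in> D" and "t0 \<ge> 0" for D t0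
  proof -
    have "open (torus_proj -` D)" "p \<in> torus_proj -` D"
      using D torus_proj_id[OF pt] by (auto simp: torus_open_def)
    then obtain e where e: "e > 0" "ball p e \<subseteq> torus_proj -` D"
      by (meson openE)
    obtain N :: nat where N: "\<And>y. \<exists>n\<le>N. \<exists>k::int. \<bar>y + real n * \<alpha> - of_int k\<bar> < e"
      using rotation_bounded_dense[OF alpha_irrational e(1)] by blast
    \<comment> \<open>\<open>M\<close> edges already take longer than \<open>t0\<close> and at least
      \<open>sync_time\<close>; \<open>n\<close> more bring the rotation within \<open>e\<close> of
      the identity. Going back \<open>K\<close> edges therefore changes \<open>p\<close>, modulo
      integers, only by less than \<open>e\<close> in height.\<close>
    define M where "M = sync_steps + 2 + nat \<lceil>t0 / speed\<rceil>"
    obtain n k where k: "\<bar>real M * \<alpha> + real n * \<alpha> - of_int k\<bar> < e"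
      using N by blast
    define K where "K = M + n"
    define q' where "q' = (fst p, snd p - real K * \<alpha> + of_int k)"
    define q where "q = torus_proj q'"
    define t where "t = real K * speed"
    have "dist p q' = \<bar>real M * \<alpha> + real n * \<alpha> - of_int k\<bar>"
      by (cases p) (simp add: q'_def K_def dist_Pair_Pair dist_real_def algebra_simps)
    then have "q' \<in> ball p e"
      using k by simp
    then have qD: "q \<in> D"
      using e(2) unfolding q_def by blast
    have qt: "q \<in> torus"
      by (simp add: q_def torus_proj_in_torus)
    have t: "t > t0"
    proof -
      have "t0 / speed < real K"
        by (simp add: K_def M_def) linarith
      then show ?thesis
        using speed_pos by (simp add: t_def field_simps)
    qed
    have "real sync_steps + 2 \<le> real K"
      by (simp add: K_def M_def)
    then have "t \<ge> sync_time"
      using speed_pos by (simp add: t_def sync_time_def)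
    then have "flow t q \<in> attractor"
      by (rule flow_eventually_attractor[OF qt])
    moreover obtain a b where "q = q' + (2 * of_int a, of_int b)"
      using torus_proj_congruent q_def by metis
    then have "fst q = fst p + of_int (2 * a)" "snd q = snd p - real K * \<alpha> + of_int (k + b)"
      by (simp_all add: q'_def)
    then have "frac (fst q + t / speed) = frac (fst p)"
      "frac (snd q + \<alpha> * (t / speed)) = frac (snd p)"
      unfolding frac_eq_iff_diff_Ints using speed_pos by (simp_all add: t_def)
    moreover have "t \<ge> 0"
      using t \<open>t0 \<ge> 0\<close> by simp
    then have "frac (fst (flow t q)) = frac (fst q + t / speed)"
      "frac (snd (flow t q)) = frac (snd q + \<alpha> * (t / speed))"
      using flow_congruent[OF qt] by (simp_all add: frac_eq_iff_diff_Ints)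
    ultimately have "flow t q = p"
      using p by (intro attractor_unique) (simp_all flip: frac_eq_iff_diff_Ints)
    then show ?thesis
      using t D qD by blast
  qed
  then show "p \<in> recurrent_set \<alpha> J"
    using pt unfolding recurrent_set_def wandering_def by blast
qed

text \<open>Off the grid, a point that is not synchronised has a neighbourhood of such points, and
  after \<open>sync_time\<close> everything is synchronised, so this neighbourhood is never met
  again.\<close>

lemma recurrent_subset: "recurrent_set \<alpha> J \<subseteq> attractor \<union> grid"
proof
  fix p assume p: "p \<in> recurrent_set \<alpha> J"
  then have pt: "p \<in> torus"
    by (simp add: recurrent_set_def)
  have "wandering \<alpha> J p" if "\<not> synced p" "p \<notin> grid"
  proof -
    obtain e where e: "e > 0" "\<And>q. dist p q < e \<Longrightarrow> synced q \<longleftrightarrow> synced p"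
      using synced_locally_constant[OF \<open>p \<notin> grid\<close>] by blast
    define D where "D = torus_proj ` ball p e"
    have "torus_open D"
      by (simp add: D_def torus_open_image)
    moreover have "p \<in> D"
      unfolding D_def using e(1) torus_proj_id[OF pt] by (intro image_eqI[of _ _ p]) auto
    moreover have "\<not> synced q" if "q \<in> D" for q
      using that e(2) \<open>\<not> synced p\<close> by (auto simp: D_def synced_torus_proj)
    moreover have "synced (flow t q)" if "q \<in> D" "t > sync_time" for t q
      using flow_eventually_attractor[of q t] that torus_proj_in_torus by (auto simp: D_def attractor_def)
    ultimately show ?thesis
      unfolding wandering_def using sync_time_nonneg by blast
  qed
  then show "p \<in> attractor \<union> grid"
    using p pt by (auto simp: recurrent_set_def attractor_def)
qed

text \<open>The preimage is found by following the linear flow backwards modulo 1 and choosing the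
  square by \<open>sync\<close>; its image is congruent to \<open>q\<close> and in the
  attractor.\<close>

lemma attractor_backward:
  assumes q: "q \<in> attractor" and t: "t \<ge> 0"
  shows "\<exists>p\<in>attractor. flow t p = q"
proof -
  define x where "x = fst q - t / speed"
  define y where "y = snd q - \<alpha> * (t / speed)"
  define b where "b = y - \<alpha> * frac x"
  define p where "p = (of_int (sync b) + frac x, frac y)"
  have fl: "\<lfloor>fst p\<rfloor> = sync b"
    using frac_lt_1 by (simp add: p_def floor_eq_iff)
  have "frac (fst p) = frac x"
    by (simp add: p_def)
  then have "base p - b \<in> \<int>"
    by (simp add: base_def b_def p_def frac_def)
  then have "synced p"
    using fl sync_cases[of b] sync_diff_int by (auto simp: synced_def)
  moreover have pt: "p \<in> torus"
    using sync_cases[of b] frac_lt_1[of x] frac_lt_1[of y] by (auto simp: p_def torus_def simp del: frac_lt_1)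
  ultimately have p: "p \<in> attractor"
    by (simp add: attractor_def)
  have "frac (fst (flow t p)) = frac (fst p + t / speed)"
    "frac (snd (flow t p)) = frac (snd p + \<alpha> * (t / speed))"
    using flow_congruent[OF pt t] by (simp_all add: frac_eq_iff_diff_Ints)
  moreover have "frac (fst p + t / speed) = frac (fst q)"
    "frac (snd p + \<alpha> * (t / speed)) = frac (snd q)"
    unfolding frac_eq_iff_diff_Ints by (simp_all add: p_def x_def y_def frac_def)
  ultimately have "flow t p = q"
    using flow_attractor[OF p t] q by (intro attractor_unique) (simp_all flip: frac_eq_iff_diff_Ints)
  then show ?thesis
    using p by blast
qed

lemma recurrent_diff_negligible: "negligible (recurrent_set \<alpha> J - attractor)"
  using recurrent_subset negligible_grid by (meson Diff_subset_conv negligible_subset)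

lemma recurrent_lmeasurable: "recurrent_set \<alpha> J \<in> lmeasurable"
  and measure_recurrent: "measure lebesgue (recurrent_set \<alpha> J) = 1"
proof -
  have eq: "recurrent_set \<alpha> J = attractor \<union> (recurrent_set \<alpha> J - attractor)"
    using attractor_recurrent by auto
  show "recurrent_set \<alpha> J \<in> lmeasurable"
    by (subst eq) (intro fmeasurable.Un attractor_lmeasurable negligible_imp_measurable recurrent_diff_negligible)
  have "sym_diff attractor (recurrent_set \<alpha> J) = recurrent_set \<alpha> J - attractor"
    using attractor_recurrent by auto
  then have "negligible (sym_diff attractor (recurrent_set \<alpha> J))"
    using recurrent_diff_negligible by simp
  then show "measure lebesgue (recurrent_set \<alpha> J) = 1"
    using measure_negligible_symdiff[OF attractor_lmeasurable] measure_attractor by metis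
qed

lemma torus_lmeasurable: "torus \<in> lmeasurable"
  using bounded_torus convex_torus by (intro measurable_convex)

lemma measure_torus: "measure lebesgue torus = 2"
proof -
  have "sym_diff (cbox (0, 0) (2, 1)) torus \<subseteq> {p. fst p = 2} \<union> {p. snd p = 1}"
    by (auto simp: torus_def)
  then have "negligible (sym_diff (cbox (0, 0) (2, 1)) torus)"
    using negligible_axis_line by (meson negligible_Un negligible_subset)
  then have "measure lebesgue torus = measure lebesgue (cbox (0, 0) (2 :: real, 1 :: real))"
    by (intro measure_negligible_symdiff) auto
  then show ?thesis
    by (simp add: content_Pair)
qed

lemma transient_eq: "transient_set \<alpha> J = torus - recurrent_set \<alpha> J"
  by (auto simp: transient_set_def recurrent_set_def)

text \<open>Replacing \<open>E\<close> by its part \<open>S\<close> in the attractor costs no area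
  and, after \<open>sync_time\<close>, no visits. The visits to \<open>S\<close> are those of the
  linear flow to \<open>fold_set S\<close>, which has the same area in the unit square.\<close>

lemma flow_uniformly_distributed:
  assumes pt: "p \<in> torus"
  shows "uniformly_distributed (\<lambda>t. flow t p) (recurrent_set \<alpha> J)"
  unfolding uniformly_distributed_def
proof (intro conjI allI impI)
  fix E assume E: "E \<subseteq> recurrent_set \<alpha> J \<and> E \<in> sets borel \<and> jordan_measurable E"
  define S where "S = E \<inter> attractor"
  have sub: "S \<subseteq> attractor"
    by (simp add: S_def)
  have frontier_S: "negligible (frontier S)"
    using E negligible_frontier_attractor frontier_Int_subset[of E attractor] unfolding S_def jordan_measurable_def
    by (meson negligible_Un negligible_subset)
  have S: "S \<in> lmeasurable"
    using frontier_S E by (intro measurable_Jordan) (auto simp: S_def jordan_measurable_def)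
  have frontier_fold: "negligible (frontier (fold_set S))"
    by (rule negligible_frontier_fold_set[OF frontier_S])
  have "sym_diff S E \<subseteq> recurrent_set \<alpha> J - attractor"
    using E by (auto simp: S_def)
  then have "measure lebesgue E = measure lebesgue S"
    using recurrent_diff_negligible by (intro measure_negligible_symdiff S) (blast intro: negligible_subset)
  also have "\<dots> = measure lebesgue (fold_set S \<inter> cbox (0, 0) (1, 1))"
    by (simp add: measure_fold_set[OF sub S] measure_cbox_unit_square[OF frontier_fold])
  finally have mE: "measure lebesgue E = measure lebesgue (fold_set S \<inter> cbox (0, 0) (1, 1))" .
  define X where "X = {t. t \<ge> 0 \<and> flow t p \<in> E}"
  obtain \<Phi> where [measurable]: "\<Phi> \<in> borel_measurable borel" and \<Phi>: "\<And>t. t \<ge> 0 \<Longrightarrow> flow t p = \<Phi> t"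
    using flow_borel_measurable[OF pt] by blast
  have "X = {0..} \<inter> \<Phi> -` E"
    using \<Phi> by (auto simp: X_def)
  moreover have "\<Phi> -` E \<in> sets borel"
    using E measurable_sets[of \<Phi> borel borel E] by simp
  ultimately have X: "X \<in> sets lebesgue"
    by (metis atLeast_borel borel_imp_lebesgue sets.Int)
  have "((\<lambda>T. measure lebesgue (X \<inter> {0..T}) / T)
      \<longlongrightarrow> measure lebesgue (fold_set S \<inter> cbox (0, 0) (1, 1))) at_top"
  proof (rule linear_flow_frequency[OF alpha_irrational _ _ _ frontier_fold X])
    show "1 / speed > 0"
      using speed_pos by simp
    have [simp]: "frac (x + 1) = frac x" for x :: real
      using frac_add_of_int_right[of x 1] by simp
    show "q + (1, 0) \<in> fold_set S \<longleftrightarrow> q \<in> fold_set S" for q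
      by (simp add: fold_set_def)
    show "q + (0, 1) \<in> fold_set S \<longleftrightarrow> q \<in> fold_set S" for q
      by (simp add: fold_set_def)
    fix t assume t: "t \<ge> sync_time"
    have "t \<in> X \<longleftrightarrow> flow t p \<in> S"
      using t sync_time_nonneg flow_eventually_attractor[OF pt t] by (auto simp: X_def S_def)
    then show "t \<in> X \<longleftrightarrow> p + t *\<^sub>R (1 / speed, \<alpha> * (1 / speed)) \<in> fold_set S"
      using flow_in_iff_fold_set[OF sub pt t] by simp
  qed
  moreover have "{t \<in> {0..T}. flow t p \<in> E} = X \<inter> {0..T}" for T
    by (auto simp: X_def)
  ultimately show "((\<lambda>T. measure lebesgue {t \<in> {0..T}. flow t p \<in> E} / T) \<longlongrightarrow>
      measure lebesgue E / measure lebesgue (recurrent_set \<alpha> J)) at_top"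
    by (simp add: measure_recurrent mE)
qed (simp add: measure_recurrent)

text \<open>One exceptional set serves all times: without the non-wandering points outside the
  attractor, what remains is the attractor, which the flow maps onto itself.\<close>

lemma flow_invariant_recurrent: "flow_invariant \<alpha> J (recurrent_set \<alpha> J)"
proof -
  have eq: "recurrent_set \<alpha> J - (recurrent_set \<alpha> J - attractor) = attractor"
    using attractor_recurrent by auto
  have "flow t ` attractor = attractor" if "t \<ge> 0" for t
    using flow_attractor[OF _ that] attractor_backward[OF _ that] by blast
  then show ?thesis
    unfolding flow_invariant_def using recurrent_diff_negligible eq by metis
qed

lemma finite_slanted_polygon_union_recurrent: "finite_slanted_polygon_union \<alpha> (recurrent_set \<alpha> J)"
  and finite_slanted_polygon_union_transient: "finite_slanted_polygon_union \<alpha> (transient_set \<alpha> J)"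
proof -
  have R: "p \<in> recurrent_set \<alpha> J \<longleftrightarrow> synced p" if "p \<in> torus" "p \<notin> grid" for p
    using that recurrent_subset attractor_recurrent by (auto simp: attractor_def)
  show "finite_slanted_polygon_union \<alpha> (recurrent_set \<alpha> J)"
    using R by (intro finite_slanted_polygon_union_synced[where b = True]) (auto simp: recurrent_set_def)
  show "finite_slanted_polygon_union \<alpha> (transient_set \<alpha> J)"
    using R by (intro finite_slanted_polygon_union_synced[where b = False]) (auto simp: transient_eq)
qed

lemma transient_lmeasurable: "transient_set \<alpha> J \<in> lmeasurable"
  and measure_transient: "measure lebesgue (transient_set \<alpha> J) = 1"
proof -
  have sub: "recurrent_set \<alpha> J \<subseteq> torus"
    by (auto simp: recurrent_set_def)
  show "transient_set \<alpha> J \<in> lmeasurable"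
    unfolding transient_eq by (intro fmeasurable.Diff torus_lmeasurable recurrent_lmeasurable)
  show "measure lebesgue (transient_set \<alpha> J) = 1"
    unfolding transient_eq
    using measurable_measure_Diff[OF torus_lmeasurable _ sub] recurrent_lmeasurable
    by (simp add: measure_torus measure_recurrent fmeasurableD)
qed

end

theorem theorem1:
  fixes \<alpha> :: real and J :: "real set"
  assumes "\<alpha> > 0" and "\<alpha> \<notin> \<rat>"
    and "finite_interval_union J"
  defines "R \<equiv> recurrent_set \<alpha> J" and "W \<equiv> transient_set \<alpha> J"
  shows "(finite_slanted_polygon_union \<alpha> R \<and> R \<in> lmeasurable \<and> measure lebesgue R = 1 \<and>
          finite_slanted_polygon_union \<alpha> W \<and> W \<in> lmeasurable \<and> measure lebesgue W = 1) \<and>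
         (flow_invariant \<alpha> J R \<and>
          (\<forall>p\<in>R. uniformly_distributed (\<lambda>t. dissipative_flow \<alpha> J t p) R)) \<and>
         (\<forall>p\<in>W. (\<exists>t\<^sub>0\<ge>0. \<forall>t\<ge>t\<^sub>0. dissipative_flow \<alpha> J t p \<in> R) \<and>
                 uniformly_distributed (\<lambda>t. dissipative_flow \<alpha> J t p) R)"
proof -
  interpret barrier_flow \<alpha> J
    using assms(1-3) by unfold_locales
  have torus: "p \<in> torus" if "p \<in> R \<or> p \<in> W" for p
    using that by (auto simp: R_def W_def recurrent_set_def transient_set_def)
  \<comment> \<open>The attractor lies in \<open>R\<close> without exceptional points, so arrival
    there holds for every starting point and not just almost every one.\<close>
  have "\<exists>t\<^sub>0\<ge>0. \<forall>t\<ge>t\<^sub>0. dissipative_flow \<alpha> J t p \<in> R" if "p \<in> W" for p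
    using flow_eventually_attractor[of p] torus[of p] that attractor_recurrent sync_time_nonneg
    unfolding R_def by blast
  then show ?thesis
    using torus finite_slanted_polygon_union_recurrent finite_slanted_polygon_union_transient
      recurrent_lmeasurable measure_recurrent transient_lmeasurable measure_transient
      flow_invariant_recurrent flow_uniformly_distributed
    unfolding R_def W_def by blast
qed

end
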